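(* Let $(M^n,g)$ be a Riemannian manifold, $f:M\to\mathbb{R}$ a smooth function, $K\in\mathbb{R}$, and suppose that $(M,g,f)$ is $CD(K,n-m)$ for some integer $m\in\{1,2,\dots,n\}$. Suppose that $h$ is a $C^3$ function in a neighborhood of a point $p\in M$ such that $\mathrm{Hess}\,h|_p$ has $m$ non-zero eigenvalues (counted with multiplicity). Let $v=e^{f/m}$. Then, at $p$, $$\frac12 v^2\Delta_f|\nabla h|^2\ \ge\ v^2\frac{(\Delta_f h)^2}{m}+v^2K|\nabla h|^2+g\big(\nabla h,\nabla(v^2\Delta_f h)\big).$$ Moreover, equality is achieved if and only if the $m$ non-zero eigenvalues of $\mathrm{Hess}\,h|_p$ are all equal and $\mathrm{Ric}_f^{n-m}(\nabla h,\nabla h)=K|\nabla h|^2$ at $p$.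
   Context: For an $n$-dimensional Riemannian manifold $(M,g)$, a smooth function $f:M\to\mathbb{R}$ and real $N\ne n$, put $$\mathrm{Ric}_f^N=\mathrm{Ric}+\mathrm{Hess} f-\frac{df\otimes df}{N-n}.$$ $(M,g,f)$ is $CD(\lambda,N)$ if $\mathrm{Ric}_f^N\ge\lambda g$. The weighted Laplacian is $\Delta_f=\Delta-D_{\nabla f}$, i.e. $\Delta_f h=\Delta h-g(\nabla f,\nabla h)$ with $\Delta=\mathrm{tr}\,\mathrm{Hess}$. *)

theory Defs
  imports "HOL-Analysis.Analysis"
begin

section \<open>Functions of class C^k on open subsets of Euclidean space\<close>

definition pderivative :: "'n::finite \<Rightarrow> (real^'n \<Rightarrow> real) \<Rightarrow> real^'n \<Rightarrow> real" where
  "pderivative i u x = frechet_derivative u (at x) (axis i 1)"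

text \<open>Intended for open S only: the derivatives are taken at interior points. For open S this
  is the usual notion, as all partial derivatives up to order k are required to exist and
  to be continuous.\<close>

primrec Ck_on :: "nat \<Rightarrow> (real^'n::finite) set \<Rightarrow> (real^'n \<Rightarrow> real) \<Rightarrow> bool" where
  "Ck_on 0 S u \<longleftrightarrow> continuous_on S u"
| "Ck_on (Suc k) S u \<longleftrightarrow>
     (\<forall>x\<in>S. u differentiable (at x)) \<and> (\<forall>i. Ck_on k S (pderivative i u))"


section \<open>Smooth manifolds\<close>

text \<open>The underlying space of a manifold is an abstract topology X. A chart is a pair (U, phi) of
  an open subset of X and a coordinate map; only the values of phi on U matter.\<close>

type_synonym ('a, 'n) chart = "'a set \<times> ('a \<Rightarrow> real^'n)"

definition is_chart :: "'a topology \<Rightarrow> ('a, 'n::finite) chart \<Rightarrow> bool" where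
  "is_chart X c \<longleftrightarrow> openin X (fst c) \<and> open (snd c ` fst c) \<and>
     homeomorphic_map (subtopology X (fst c)) (top_of_set (snd c ` fst c)) (snd c)"

definition chart_inv :: "('a, 'n::finite) chart \<Rightarrow> real^'n \<Rightarrow> 'a" where
  "chart_inv c = inv_into (fst c) (snd c)"

text \<open>Regularity of u on (the part inside the chart domain of) the open set W, read in the
  coordinates of c.\<close>

definition Ck_in_chart :: "nat \<Rightarrow> ('a, 'n::finite) chart \<Rightarrow> 'a set \<Rightarrow> ('a \<Rightarrow> real) \<Rightarrow> bool" where
  "Ck_in_chart k c W u \<longleftrightarrow> Ck_on k (snd c ` (fst c \<inter> W)) (u \<circ> chart_inv c)"

text \<open>The atlas A is a smooth atlas; it need not be maximal.\<close>

locale smooth_manifold =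
  fixes X :: "'a topology"
    and A :: "('a, 'n::finite) chart set"
  assumes hausdorff: "Hausdorff_space X"
    and second_countable: "second_countable X"
    and charts: "\<And>c. c \<in> A \<Longrightarrow> is_chart X c"
    and cover: "(\<Union>c\<in>A. fst c) = topspace X"
    and compatible: "\<And>c c' i k. c \<in> A \<Longrightarrow> c' \<in> A \<Longrightarrow> Ck_in_chart k c (fst c') (\<lambda>q. snd c' q $ i)"

definition Ck_function ::
    "nat \<Rightarrow> ('a, 'n::finite) chart set \<Rightarrow> 'a set \<Rightarrow> ('a \<Rightarrow> real) \<Rightarrow> bool" where
  "Ck_function k A W u \<longleftrightarrow> (\<forall>c\<in>A. Ck_in_chart k c W u)"

definition smooth_function :: "('a, 'n::finite) chart set \<Rightarrow> 'a set \<Rightarrow> ('a \<Rightarrow> real) \<Rightarrow> bool" where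
  "smooth_function A W u \<longleftrightarrow> (\<forall>k. Ck_function k A W u)"

text \<open>The coordinate vector field with index i of the chart c, applied to u; again a function on
  the manifold, meaningful on the domain of c.\<close>

definition cpd :: "('a, 'n::finite) chart \<Rightarrow> 'n \<Rightarrow> ('a \<Rightarrow> real) \<Rightarrow> 'a \<Rightarrow> real" where
  "cpd c i u q = pderivative i (u \<circ> chart_inv c) (snd c q)"


section \<open>Riemannian metrics\<close>

text \<open>Tensor fields are given by their components with respect to the coordinate frames:
  \<open>g c q $ i $ j\<close> is the value of the metric at q on the i-th and j-th coordinate vector fields
  of the chart c. The assumption \<open>tensorial\<close> is the transformation law of a covariant 2-tensor.\<close>

locale riemannian_manifold = smooth_manifold X A
  for X :: "'a topology" and A :: "('a, 'n::finite) chart set" +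
  fixes g :: "('a, 'n) chart \<Rightarrow> 'a \<Rightarrow> real^'n^'n"
  assumes metric_smooth: "\<And>c i j k. c \<in> A \<Longrightarrow> Ck_in_chart k c (fst c) (\<lambda>q. g c q $ i $ j)"
    and metric_symmetric: "\<And>c q. c \<in> A \<Longrightarrow> q \<in> fst c \<Longrightarrow> transpose (g c q) = g c q"
    and metric_positive: "\<And>c q \<xi>. c \<in> A \<Longrightarrow> q \<in> fst c \<Longrightarrow> \<xi> \<noteq> 0 \<Longrightarrow> \<xi> \<bullet> (g c q *v \<xi>) > 0"
    and tensorial: "\<And>c c' q i j. c \<in> A \<Longrightarrow> c' \<in> A \<Longrightarrow> q \<in> fst c \<inter> fst c' \<Longrightarrow>
      g c q $ i $ j = (\<Sum>k\<in>UNIV. \<Sum>l\<in>UNIV.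
        cpd c i (\<lambda>r. snd c' r $ k) q * cpd c j (\<lambda>r. snd c' r $ l) q * g c' q $ k $ l)"

text \<open>All objects below are computed in the coordinates of a chart c, at points of its domain.
  A tangent vector at q is represented by its components in the coordinate frame of c.
  Scalars obtained this way do not depend on the chart.\<close>

definition ip :: "(('a, 'n::finite) chart \<Rightarrow> 'a \<Rightarrow> real^'n^'n) \<Rightarrow> ('a, 'n) chart
    \<Rightarrow> 'a \<Rightarrow> real^'n \<Rightarrow> real^'n \<Rightarrow> real" where
  "ip g c q \<xi> \<eta> = \<xi> \<bullet> (g c q *v \<eta>)"

definition differential :: "('a, 'n::finite) chart \<Rightarrow> ('a \<Rightarrow> real) \<Rightarrow> 'a \<Rightarrow> real^'n" where
  "differential c u q = (\<chi> i. cpd c i u q)"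

definition grad :: "(('a, 'n::finite) chart \<Rightarrow> 'a \<Rightarrow> real^'n^'n) \<Rightarrow> ('a, 'n) chart
    \<Rightarrow> ('a \<Rightarrow> real) \<Rightarrow> 'a \<Rightarrow> real^'n" where
  "grad g c u q = matrix_inv (g c q) *v differential c u q"

definition grad_norm_sq :: "(('a, 'n::finite) chart \<Rightarrow> 'a \<Rightarrow> real^'n^'n) \<Rightarrow> ('a, 'n) chart
    \<Rightarrow> ('a \<Rightarrow> real) \<Rightarrow> 'a \<Rightarrow> real" where
  "grad_norm_sq g c u q = ip g c q (grad g c u q) (grad g c u q)"

text \<open>Christoffel symbols of the Levi-Civita connection:
  \<open>christoffel g c k i j\<close> has the upper index k and the lower indices i, j.\<close>

definition christoffel :: "(('a, 'n::finite) chart \<Rightarrow> 'a \<Rightarrow> real^'n^'n) \<Rightarrow> ('a, 'n) chart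
    \<Rightarrow> 'n \<Rightarrow> 'n \<Rightarrow> 'n \<Rightarrow> 'a \<Rightarrow> real" where
  "christoffel g c k i j q = (\<Sum>l\<in>UNIV. matrix_inv (g c q) $ k $ l *
     (cpd c i (\<lambda>r. g c r $ j $ l) q + cpd c j (\<lambda>r. g c r $ i $ l) q
       - cpd c l (\<lambda>r. g c r $ i $ j) q)) / 2"

text \<open>\<open>riemann g c l k i j\<close> is the l-th component of \<open>R(\<partial>\<^sub>i, \<partial>\<^sub>j)\<partial>\<^sub>k\<close>, where
  \<open>R(Y, Z) = \<nabla>\<^sub>Y\<nabla>\<^sub>Z - \<nabla>\<^sub>Z\<nabla>\<^sub>Y - \<nabla>\<^bsub>[Y,Z]\<^esub>\<close>, and \<open>Ric(Y, Z)\<close> is the trace of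
  \<open>W \<mapsto> R(W, Y)Z\<close>, so that round spheres have positive Ricci curvature.\<close>

definition riemann :: "(('a, 'n::finite) chart \<Rightarrow> 'a \<Rightarrow> real^'n^'n) \<Rightarrow> ('a, 'n) chart
    \<Rightarrow> 'n \<Rightarrow> 'n \<Rightarrow> 'n \<Rightarrow> 'n \<Rightarrow> 'a \<Rightarrow> real" where
  "riemann g c l k i j q =
     cpd c i (christoffel g c l j k) q - cpd c j (christoffel g c l i k) q
     + (\<Sum>s\<in>UNIV. christoffel g c l i s q * christoffel g c s j k q
              - christoffel g c l j s q * christoffel g c s i k q)"

definition ricci :: "(('a, 'n::finite) chart \<Rightarrow> 'a \<Rightarrow> real^'n^'n) \<Rightarrow> ('a, 'n) chart
    \<Rightarrow> 'a \<Rightarrow> real^'n^'n" where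
  "ricci g c q = (\<chi> j k. \<Sum>i\<in>UNIV. riemann g c i k i j q)"

definition hess :: "(('a, 'n::finite) chart \<Rightarrow> 'a \<Rightarrow> real^'n^'n) \<Rightarrow> ('a, 'n) chart
    \<Rightarrow> ('a \<Rightarrow> real) \<Rightarrow> 'a \<Rightarrow> real^'n^'n" where
  "hess g c u q = (\<chi> i j. cpd c i (cpd c j u) q - (\<Sum>k\<in>UNIV. christoffel g c k i j q * cpd c k u q))"

text \<open>The Hessian as an endomorphism of the tangent space, obtained by raising an index; its
  eigenvalues and trace are those of the Hessian with respect to the metric.\<close>

definition hess_endo :: "(('a, 'n::finite) chart \<Rightarrow> 'a \<Rightarrow> real^'n^'n) \<Rightarrow> ('a, 'n) chart
    \<Rightarrow> ('a \<Rightarrow> real) \<Rightarrow> 'a \<Rightarrow> real^'n^'n" where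
  "hess_endo g c u q = matrix_inv (g c q) ** hess g c u q"

definition laplacian :: "(('a, 'n::finite) chart \<Rightarrow> 'a \<Rightarrow> real^'n^'n) \<Rightarrow> ('a, 'n) chart
    \<Rightarrow> ('a \<Rightarrow> real) \<Rightarrow> 'a \<Rightarrow> real" where
  "laplacian g c u q = trace (hess_endo g c u q)"


section \<open>Weighted manifolds\<close>

definition weighted_laplacian :: "(('a, 'n::finite) chart \<Rightarrow> 'a \<Rightarrow> real^'n^'n) \<Rightarrow> ('a, 'n) chart
    \<Rightarrow> ('a \<Rightarrow> real) \<Rightarrow> ('a \<Rightarrow> real) \<Rightarrow> 'a \<Rightarrow> real" where
  "weighted_laplacian g c f u q = laplacian g c u q - ip g c q (grad g c f q) (grad g c u q)"

definition ric_weighted :: "(('a, 'n::finite) chart \<Rightarrow> 'a \<Rightarrow> real^'n^'n) \<Rightarrow> ('a, 'n) chart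
    \<Rightarrow> ('a \<Rightarrow> real) \<Rightarrow> real \<Rightarrow> 'a \<Rightarrow> real^'n^'n" where
  "ric_weighted g c f N q = ricci g c q + hess g c f q
     - (\<chi> i j. differential c f q $ i * differential c f q $ j / (N - real CARD('n)))"

definition CD :: "('a, 'n::finite) chart set \<Rightarrow> (('a, 'n) chart \<Rightarrow> 'a \<Rightarrow> real^'n^'n)
    \<Rightarrow> ('a \<Rightarrow> real) \<Rightarrow> real \<Rightarrow> real \<Rightarrow> bool" where
  "CD A g f K N \<longleftrightarrow> N \<noteq> real CARD('n) \<and>
     (\<forall>c\<in>A. \<forall>q\<in>fst c. \<forall>\<xi>. \<xi> \<bullet> (ric_weighted g c f N q *v \<xi>) \<ge> K * ip g c q \<xi> \<xi>)"


section \<open>Eigenvalues\<close>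

definition eigenvalues :: "real^'n^'n::finite \<Rightarrow> real set" where
  "eigenvalues B = {\<mu>. \<exists>x. x \<noteq> 0 \<and> B *v x = \<mu> *\<^sub>R x}"

text \<open>The multiplicity is the dimension of the eigenspace; the endomorphisms considered here are
  self-adjoint with respect to the metric, so it agrees with the algebraic multiplicity.\<close>

definition num_nonzero_eigenvalues :: "real^'n^'n::finite \<Rightarrow> nat" where
  "num_nonzero_eigenvalues B =
     (\<Sum>\<mu>\<in>eigenvalues B - {0}. dim {x. B *v x = \<mu> *\<^sub>R x})"

end

theory Submission
  imports Defs
begin

text \<open>
  With \<open>V = \<nabla>h\<close> and \<open>T = \<nabla>V = Hess h\<close> (as an endomorphism), commuting covariant derivatives of \<open>V\<close>
  and tracing gives Bochner's formula
  \<open>\<Delta>|\<nabla>h|\<^sup>2 / 2 = g(\<nabla>h, \<nabla>\<Delta>h) + tr T\<^sup>2 + Ric(\<nabla>h, \<nabla>h)\<close>. Passing to \<open>\<Delta>\<^sub>f\<close> adds \<open>Hess f(\<nabla>h, \<nabla>h)\<close>, and the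
  derivative of \<open>v\<^sup>2 = exp(2f/m)\<close> completes the square \<open>(\<Delta>\<^sub>f h + g(\<nabla>f, \<nabla>h))\<^sup>2 = (tr T)\<^sup>2\<close>, so that the
  difference of the two sides is
  \<open>v\<^sup>2 (tr T\<^sup>2 - (tr T)\<^sup>2 / m + (Ric\<^sub>f - K g)(\<nabla>h, \<nabla>h))\<close>. As \<open>T\<close> is self-adjoint with \<open>m\<close> non-zero
  eigenvalues, the first part is non-negative by the Cauchy-Schwarz inequality, with equality iff
  these eigenvalues agree.
\<close>

text \<open>Everything is computed in the given chart, whose Christoffel symbols need not vanish at
  \<open>p\<close>. The curvature therefore has to emerge from finite sums of coordinate
  derivatives, and Bochner's formula becomes an algebraic identity at one point. Class C^3 provides
  just the derivatives this takes: the gradient of \<open>h\<close> is C^2, so its mixed second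
  derivatives commute, and the entries of \<open>T\<close> are C^1, so they can be differentiated
  once. In coordinates \<open>T\<close> need not be a symmetric matrix, but
  \<open>g c p ** T\<close> is; hence the spectral theorem is proved relative to the inner product
  given by the metric. The number m enters in three places that have to match. As N - n = -m, the
  df-term of the weighted Ricci tensor is + g(grad f, grad h)^2 / m; the derivative of v^2 =
  exp(2f/m) carries the factor 2/m; and Cauchy-Schwarz for m numbers has the constant 1/m. This is
  what lets all terms in g(grad f, grad h) merge into one square.\<close>

section \<open>Calculus of partial derivatives\<close>

lemma pderivative_eqI:
  assumes "(u has_derivative u') (at x)"
  shows "pderivative i u x = u' (axis i 1)"
  unfolding pderivative_def using frechet_derivative_at[OF assms] by metis

lemma pderivative_cong_open:
  assumes "open S" "x \<in> S" "\<And>y. y \<in> S \<Longrightarrow> u y = w y"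
  shows "pderivative i u x = pderivative i w x"
proof (cases "u differentiable (at x)")
  case True
  then show ?thesis
    unfolding pderivative_def
    using frechet_derivative_transform_within_open[of u x S w] assms by metis
next
  \<comment> \<open>\<open>frechet_derivative\<close> is a choice term. Where no derivative exists,
    the choice predicates for \<open>u\<close> and \<open>w\<close> are both identically false, so
    even the arbitrary values agree.\<close>
  case False
  have "\<not> (u has_derivative D) (at x)" "\<not> (w has_derivative D) (at x)" for D
  proof -
    show *: "\<not> (u has_derivative D) (at x)"
      using False by (auto simp: differentiable_def)
    show "\<not> (w has_derivative D) (at x)"
      using False has_derivative_transform_within_open[of w D x UNIV S u] assms
      by (auto simp: differentiable_def)
  qed
  then have "frechet_derivative u (at x) = frechet_derivative w (at x)"
    unfolding frechet_derivative_def by simp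
  then show ?thesis unfolding pderivative_def by simp
qed

lemma differentiable_cong_open:
  assumes "open S" "x \<in> S" "\<And>y. y \<in> S \<Longrightarrow> u y = w y" "u differentiable (at x)"
  shows "w differentiable (at x)"
  using assms has_derivative_transform_within_open[of u _ x UNIV S w]
  unfolding differentiable_def by blast

lemma pderivative_add:
  assumes "u differentiable (at x)" "w differentiable (at x)"
  shows "pderivative i (\<lambda>y. u y + w y) x = pderivative i u x + pderivative i w x"
  unfolding pderivative_def[of i u] pderivative_def[of i w]
  by (rule pderivative_eqI) (intro has_derivative_add assms[unfolded frechet_derivative_works])

lemma pderivative_mult:
  assumes "u differentiable (at x)" "w differentiable (at x)"
  shows "pderivative i (\<lambda>y. u y * w y) x = u x * pderivative i w x + pderivative i u x * w x"
  unfolding pderivative_def[of i u] pderivative_def[of i w]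
  by (rule pderivative_eqI) (intro has_derivative_mult assms[unfolded frechet_derivative_works])

lemma pderivative_const: "pderivative i (\<lambda>y. k) x = 0"
  by (simp add: pderivative_def)

lemma pderivative_inverse:
  assumes "u differentiable (at x)" "u x \<noteq> 0"
  shows "pderivative i (\<lambda>y. inverse (u y)) x = - (inverse (u x) * (pderivative i u x * inverse (u x)))"
  using pderivative_eqI[OF Deriv.has_derivative_inverse[OF assms(2) assms(1)[unfolded frechet_derivative_works]], of i]
  by (simp add: pderivative_def)

lemma pderivative_exp:
  assumes "u differentiable (at x)"
  shows "pderivative i (\<lambda>y. exp (u y)) x = exp (u x) * pderivative i u x"
  unfolding pderivative_def[of i u]
  using has_derivative_exp[OF assms(1)[unfolded frechet_derivative_works]]
  by (rule pderivative_eqI[THEN trans]) simp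

text \<open>\<open>Ck_on\<close> recurses on \<open>pderivative i u\<close> as a function on the
  whole space, whereas product, chain and quotient rules describe it only on \<open>S\<close>. This
  lemma bridges the gap in all closure proofs below.\<close>

lemma Ck_on_cong:
  assumes "open S" "\<And>y. y \<in> S \<Longrightarrow> u y = w y"
  shows "Ck_on k S u \<longleftrightarrow> Ck_on k S w"
  using assms(2)
proof (induction k arbitrary: u w)
  case 0
  then show ?case by (simp cong: continuous_on_cong)
next
  case (Suc k)
  have "Ck_on k S (pderivative i u) \<longleftrightarrow> Ck_on k S (pderivative i w)" for i
    by (rule Suc.IH) (rule pderivative_cong_open[OF assms(1)], simp_all add: Suc.prems)
  moreover have "u differentiable (at x) \<longleftrightarrow> w differentiable (at x)" if "x \<in> S" for x
    using that Suc.prems assms(1) differentiable_cong_open[of S x u w]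
      differentiable_cong_open[of S x w u] by metis
  ultimately show ?case by simp
qed

lemma Ck_on_SucD: "Ck_on (Suc k) S u \<Longrightarrow> Ck_on k S u"
proof (induction k arbitrary: u)
  case 0
  then show ?case
    by (auto intro!: continuous_at_imp_continuous_on differentiable_imp_continuous_within)
next
  case (Suc k)
  then show ?case by (simp only: Ck_on.simps(2)) blast
qed

lemma Ck_on_le: "k \<le> l \<Longrightarrow> Ck_on l S u \<Longrightarrow> Ck_on k S u"
  by (induction l rule: dec_induct) (auto dest: Ck_on_SucD simp del: Ck_on.simps)

lemma Ck_on_subset: "Ck_on k S u \<Longrightarrow> T \<subseteq> S \<Longrightarrow> Ck_on k T u"
  by (induction k arbitrary: u) (auto intro: continuous_on_subset)

lemma Ck_on_differentiable: "Ck_on k S u \<Longrightarrow> k > 0 \<Longrightarrow> x \<in> S \<Longrightarrow> u differentiable (at x)"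
  by (cases k) auto

lemma Ck_on_const: "Ck_on k S (\<lambda>y. a)"
proof (induction k arbitrary: a)
  case (Suc k)
  have "pderivative i (\<lambda>y. a) = (\<lambda>y. 0)" for i :: 'a
    by (simp add: fun_eq_iff pderivative_const)
  then show ?case using Suc by simp
qed simp

lemma Ck_on_add:
  assumes "open S" "Ck_on k S u" "Ck_on k S w"
  shows "Ck_on k S (\<lambda>y. u y + w y)"
  using assms(2,3)
proof (induction k arbitrary: u w)
  case 0
  then show ?case by (simp add: continuous_on_add)
next
  case (Suc k)
  have "Ck_on k S (pderivative i (\<lambda>y. u y + w y))" for i
    using Suc Ck_on_cong[OF assms(1), of "pderivative i (\<lambda>y. u y + w y)"
        "\<lambda>x. pderivative i u x + pderivative i w x" k]
    by (simp add: pderivative_add)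
  then show ?case using Suc by simp
qed

lemma Ck_on_mult:
  assumes "open S" "Ck_on k S u" "Ck_on k S w"
  shows "Ck_on k S (\<lambda>y. u y * w y)"
  using assms(2,3)
proof (induction k arbitrary: u w)
  case 0
  then show ?case by (simp add: continuous_on_mult)
next
  case (Suc k)
  have "Ck_on k S (pderivative i (\<lambda>y. u y * w y))" for i
    using Suc.prems Ck_on_cong[OF assms(1), of "pderivative i (\<lambda>y. u y * w y)"
        "\<lambda>x. u x * pderivative i w x + pderivative i u x * w x" k]
      Ck_on_SucD[OF Suc.prems(1)] Ck_on_SucD[OF Suc.prems(2)]
    by (simp add: pderivative_mult Ck_on_add[OF assms(1)] Suc.IH)
  then show ?case using Suc by simp
qed

text \<open>The derivative of 1/u is a product of 1/u and first derivatives of u, so regularity of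
  1/u at the previous order is all that the induction needs.\<close>

lemma Ck_on_inverse:
  assumes "open S" "Ck_on k S u" "\<And>y. y \<in> S \<Longrightarrow> u y \<noteq> 0"
  shows "Ck_on k S (\<lambda>y. inverse (u y))"
  using assms(2)
proof (induction k)
  case 0
  then show ?case using assms(3) by (auto intro: continuous_on_inverse)
next
  case (Suc k)
  have 1: "Ck_on k S (\<lambda>y. inverse (u y))"
    using Suc Ck_on_SucD by blast
  have "Ck_on k S (\<lambda>x. (- 1) * (inverse (u x) * (pderivative i u x * inverse (u x))))" for i
    using Suc.prems by (intro Ck_on_mult[OF assms(1)] Ck_on_const 1) simp_all
  then have "Ck_on k S (pderivative i (\<lambda>y. inverse (u y)))" for i
    using Suc.prems assms(3) Ck_on_cong[OF assms(1), of "pderivative i (\<lambda>y. inverse (u y))"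
        "\<lambda>x. (- 1) * (inverse (u x) * (pderivative i u x * inverse (u x)))" k]
    by (simp add: pderivative_inverse)
  moreover have "(\<lambda>y. inverse (u y)) differentiable (at x)" if "x \<in> S" for x
    using Suc.prems assms(3) that
      Deriv.has_derivative_inverse[of u x "frechet_derivative u (at x)" UNIV]
    by (auto simp: frechet_derivative_works[of u] intro: differentiableI)
  ultimately show ?case by simp
qed

lemma Ck_on_exp:
  assumes "open S" "Ck_on k S u"
  shows "Ck_on k S (\<lambda>y. exp (u y))"
  using assms(2)
proof (induction k)
  case 0
  then show ?case by (simp add: continuous_on_exp)
next
  case (Suc k)
  have "Ck_on k S (\<lambda>x. exp (u x) * pderivative i u x)" for i
    using Suc Ck_on_SucD[OF Suc.prems] by (intro Ck_on_mult[OF assms(1)]) simp_all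
  then have "Ck_on k S (pderivative i (\<lambda>y. exp (u y)))" for i
    using Suc.prems Ck_on_cong[OF assms(1), of "pderivative i (\<lambda>y. exp (u y))"
        "\<lambda>x. exp (u x) * pderivative i u x" k]
    by (simp add: pderivative_exp)
  moreover have "(\<lambda>y. exp (u y)) differentiable (at x)" if "x \<in> S" for x
    using Suc.prems that has_derivative_exp[of u "frechet_derivative u (at x)" x UNIV]
    by (auto simp: frechet_derivative_works[of u] intro: differentiableI)
  ultimately show ?case by simp
qed

lemma Ck_on_sum:
  assumes "open S" "\<And>a. a \<in> I \<Longrightarrow> Ck_on k S (u a)"
  shows "Ck_on k S (\<lambda>y. \<Sum>a\<in>I. u a y)"
  using assms(2)
proof (induction I rule: infinite_finite_induct)
  case (insert a I)
  then show ?case using Ck_on_add[OF assms(1), of k "u a"] by simp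
qed (simp_all add: Ck_on_const)

lemma Ck_on_prod:
  assumes "open S" "\<And>a. a \<in> I \<Longrightarrow> Ck_on k S (u a)"
  shows "Ck_on k S (\<lambda>y. \<Prod>a\<in>I. u a y)"
  using assms(2)
proof (induction I rule: infinite_finite_induct)
  case (insert a I)
  then show ?case using Ck_on_mult[OF assms(1), of k "u a"] by simp
qed (simp_all add: Ck_on_const)

lemma Ck_on_det:
  assumes "open S" "\<And>i j. Ck_on k S (\<lambda>y. M y $ i $ j)"
  shows "Ck_on k S (\<lambda>y. det (M y))"
  unfolding det_def by (intro Ck_on_sum Ck_on_mult Ck_on_const Ck_on_prod assms)

lemma matrix_inv_mul:
  fixes M :: "real^'n^'n"
  assumes "det M \<noteq> 0"
  shows "M ** matrix_inv M = mat 1" "matrix_inv M ** M = mat 1"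
proof -
  have "\<exists>M'. M ** M' = mat 1 \<and> M' ** M = mat 1"
    using assms by (simp add: invertible_det_nz[symmetric] invertible_def)
  then have "M ** matrix_inv M = mat 1 \<and> matrix_inv M ** M = mat 1"
    unfolding matrix_inv_def by (rule someI_ex)
  then show "M ** matrix_inv M = mat 1" "matrix_inv M ** M = mat 1" by auto
qed

text \<open>Cramer's rule, applied to the columns of the inverse, exhibits each entry as a quotient
  of determinants. Regularity of the inverse metric then reduces to sums, products and one
  reciprocal.\<close>

lemma matrix_inv_cramer:
  fixes M :: "real^'n^'n"
  assumes "det M \<noteq> 0"
  shows "matrix_inv M $ k $ l = det (\<chi> i j. if j = k then axis l 1 $ i else M $ i $ j) * inverse (det M)"
proof -
  let ?x = "matrix_inv M *v axis l 1"
  have "M *v ?x = axis l 1"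
    by (simp add: matrix_vector_mul_assoc matrix_inv_mul[OF assms])
  then have "?x = (\<chi> k. det (\<chi> i j. if j = k then axis l 1 $ i else M $ i $ j) / det M)"
    using cramer[OF assms] by blast
  moreover have "?x $ k = matrix_inv M $ k $ l"
    by (simp add: matrix_vector_mult_basis column_def)
  ultimately show ?thesis by (simp add: divide_inverse)
qed

lemma Ck_on_matrix_inv:
  fixes M :: "real^'m \<Rightarrow> real^'n^'n"
  assumes "open S" "\<And>i j. Ck_on k S (\<lambda>y. M y $ i $ j)" "\<And>y. y \<in> S \<Longrightarrow> det (M y) \<noteq> 0"
  shows "Ck_on k S (\<lambda>y. matrix_inv (M y) $ i $ j)"
proof -
  \<comment> \<open>Each entry of the matrix in Cramer's rule is either a constant or an entry of
    \<open>M\<close>.\<close>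
  have "Ck_on k S (\<lambda>y. if b then axis j 1 $ a else M y $ a $ c)" for a b c
    by (cases b) (simp_all add: assms Ck_on_const)
  then have "Ck_on k S (\<lambda>y. det (\<chi> a b. if b = i then axis j 1 $ a else M y $ a $ b)
      * inverse (det (M y)))"
    by (intro Ck_on_mult Ck_on_inverse Ck_on_det assms) auto
  then show ?thesis
    by (subst Ck_on_cong[OF assms(1) matrix_inv_cramer[OF assms(3)]])
qed

section \<open>Symmetry of mixed second partial derivatives\<close>

lemma pderivative_has_real_derivative:
  assumes "u differentiable (at (z + s *\<^sub>R axis i 1))"
  shows "((\<lambda>s. u (z + s *\<^sub>R axis i 1)) has_real_derivative pderivative i u (z + s *\<^sub>R axis i 1)) (at s)"
proof -
  let ?D = "frechet_derivative u (at (z + s *\<^sub>R axis i 1))"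
  have "((\<lambda>s. u (z + s *\<^sub>R axis i 1)) has_derivative (\<lambda>h. ?D (h *\<^sub>R axis i 1))) (at s)"
    by (rule has_derivative_compose[where g = u and f = "\<lambda>s. z + s *\<^sub>R axis i 1"])
      (use assms in \<open>auto intro!: derivative_eq_intros simp: frechet_derivative_works\<close>)
  moreover have "?D (h *\<^sub>R axis i 1) = pderivative i u (z + s *\<^sub>R axis i 1) * h" for h
    using linear_cmul[OF linear_frechet_derivative[OF assms]] by (simp add: pderivative_def)
  ultimately show ?thesis by (simp add: has_field_derivative_def)
qed

text \<open>Two applications of the one-variable mean value theorem, first in direction
  \<open>i\<close> to a difference in direction \<open>j\<close>, then in direction
  \<open>j\<close>. The left-hand side is symmetric in \<open>i\<close> and \<open>j\<close>, while
  the order of differentiation on the right is not.\<close>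

lemma second_difference_mvt:
  assumes "Ck_on 2 S u" "ball x (3 * t) \<subseteq> S" "0 < t"
  obtains y where "dist x y < 3 * t"
    "u (x + t *\<^sub>R axis i 1 + t *\<^sub>R axis j 1) - u (x + t *\<^sub>R axis i 1) - u (x + t *\<^sub>R axis j 1) + u x
       = t * t * pderivative j (pderivative i u) y"
proof -
  \<comment> \<open>A displacement inside the square has norm at most 2t; the radius 3t leaves room
    for a strict inequality.\<close>
  have dist_less: "dist x (x + s *\<^sub>R axis i 1 + s' *\<^sub>R axis j 1) < 3 * t"
    if "0 \<le> s" "s \<le> t" "0 \<le> s'" "s' \<le> t" for s s'
  proof -
    have "norm (s *\<^sub>R axis i 1 + s' *\<^sub>R axis j (1::real)) \<le> s + s'"
      using norm_triangle_ineq[of "s *\<^sub>R axis i 1" "s' *\<^sub>R axis j (1::real)"] that by simp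
    moreover have "dist x (x + s *\<^sub>R axis i 1 + s' *\<^sub>R axis j 1)
        = norm (s *\<^sub>R axis i 1 + s' *\<^sub>R axis j (1::real))"
      by (metis add.assoc add_diff_cancel_left' dist_commute dist_norm)
    ultimately show ?thesis using that assms(3) by linarith
  qed
  have in_S: "x + s *\<^sub>R axis i 1 + s' *\<^sub>R axis j 1 \<in> S"
    if "0 \<le> s" "s \<le> t" "0 \<le> s'" "s' \<le> t" for s s'
    using dist_less[OF that] assms(2) by auto
  have u1: "u differentiable (at z)" and u2: "pderivative i u differentiable (at z)"
    if "z \<in> S" for z
    using assms(1) that by (simp_all add: numeral_2_eq_2)
  define F where "F s = u ((x + t *\<^sub>R axis j 1) + s *\<^sub>R axis i 1) - u (x + s *\<^sub>R axis i 1)" for s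
  have "(F has_real_derivative pderivative i u ((x + t *\<^sub>R axis j 1) + s *\<^sub>R axis i 1)
      - pderivative i u (x + s *\<^sub>R axis i 1)) (at s)" if "0 \<le> s" "s \<le> t" for s
    unfolding F_def
    using u1[OF in_S[of s 0]] u1[OF in_S[of s t]] that assms(3)
    by (intro DERIV_diff pderivative_has_real_derivative) (simp_all add: add_ac)
  then obtain s where s: "0 < s" "s < t"
    "F t - F 0 = t * (pderivative i u ((x + t *\<^sub>R axis j 1) + s *\<^sub>R axis i 1)
      - pderivative i u (x + s *\<^sub>R axis i 1))"
    using MVT2[OF assms(3), of F "\<lambda>s. pderivative i u ((x + t *\<^sub>R axis j 1) + s *\<^sub>R axis i 1)
      - pderivative i u (x + s *\<^sub>R axis i 1)"] by auto
  define G where "G s' = pderivative i u ((x + s *\<^sub>R axis i 1) + s' *\<^sub>R axis j 1)" for s'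
  have "(G has_real_derivative pderivative j (pderivative i u)
      ((x + s *\<^sub>R axis i 1) + s' *\<^sub>R axis j 1)) (at s')" if "0 \<le> s'" "s' \<le> t" for s'
    unfolding G_def
    using u2[OF in_S[of s s']] that s
    by (intro pderivative_has_real_derivative) (simp_all add: add_ac)
  then obtain s' where s': "0 < s'" "s' < t"
    "G t - G 0 = t * pderivative j (pderivative i u) ((x + s *\<^sub>R axis i 1) + s' *\<^sub>R axis j 1)"
    using MVT2[OF assms(3), of G "\<lambda>s'. pderivative j (pderivative i u)
      ((x + s *\<^sub>R axis i 1) + s' *\<^sub>R axis j 1)"] by auto
  have "F t - F 0 = t * (G t - G 0)"
    using s(3) by (simp add: G_def add_ac)
  also have "\<dots> = t * t * pderivative j (pderivative i u) ((x + s *\<^sub>R axis i 1) + s' *\<^sub>R axis j 1)"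
    using s'(3) by simp
  finally show thesis
    using that[OF dist_less[of s s']] s s' by (simp add: F_def algebra_simps)
qed

text \<open>Schwarz's theorem: the same second difference represents both mixed derivatives, each at
  its own point near \<open>x\<close>, and continuity carries the equality to
  \<open>x\<close>.\<close>

lemma pderivative_commute:
  assumes "open S" "Ck_on 2 S u" "x \<in> S"
  shows "pderivative i (pderivative j u) x = pderivative j (pderivative i u) x"
proof (rule ccontr)
  assume neq: "\<not> ?thesis"
  \<comment> \<open>Half the supposed gap: a common value closer than \<open>e\<close> to both mixed
    derivatives at \<open>x\<close> is impossible.\<close>
  define e where "e = \<bar>pderivative i (pderivative j u) x - pderivative j (pderivative i u) x\<bar> / 2"
  have e: "e > 0" using neq by (simp add: e_def)
  have "continuous (at x) (pderivative a (pderivative b u))" for a b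
    using assms by (simp add: numeral_2_eq_2 continuous_on_eq_continuous_at)
  then have "\<exists>d>0. \<forall>y. dist y x < d \<longrightarrow>
      dist (pderivative a (pderivative b u) y) (pderivative a (pderivative b u) x) < e" for a b
    using e by (auto simp: continuous_at_eps_delta dist_norm)
  then obtain d where d: "\<And>a b. d a b > 0" "\<And>a b y. dist y x < d a b \<Longrightarrow>
      dist (pderivative a (pderivative b u) y) (pderivative a (pderivative b u) x) < e"
    by metis
  obtain r where r: "r > 0" "ball x r \<subseteq> S"
    using assms(1,3) open_contains_ball by blast
  define t where "t = min r (min (d i j) (d j i)) / 3"
  have t: "t > 0" "3 * t \<le> r" "3 * t \<le> d i j" "3 * t \<le> d j i"
    using r d(1) by (auto simp: t_def)
  have sub: "ball x (3 * t) \<subseteq> S" using t(2) r(2) by (meson subset_ball subset_trans)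
  from second_difference_mvt[OF assms(2) sub t(1), of i j] obtain y where
    y: "dist x y < 3 * t" "u (x + t *\<^sub>R axis i 1 + t *\<^sub>R axis j 1) - u (x + t *\<^sub>R axis i 1)
      - u (x + t *\<^sub>R axis j 1) + u x = t * t * pderivative j (pderivative i u) y" .
  from second_difference_mvt[OF assms(2) sub t(1), of j i] obtain z where
    z: "dist x z < 3 * t" "u (x + t *\<^sub>R axis j 1 + t *\<^sub>R axis i 1) - u (x + t *\<^sub>R axis j 1)
      - u (x + t *\<^sub>R axis i 1) + u x = t * t * pderivative i (pderivative j u) z" .
  have "x + t *\<^sub>R axis j 1 + t *\<^sub>R axis i 1 = x + t *\<^sub>R axis i 1 + t *\<^sub>R axis j (1::real)"
    by simp
  then have "t * t * pderivative j (pderivative i u) y = t * t * pderivative i (pderivative j u) z"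
    using y(2) z(2) by (simp add: algebra_simps)
  then have "pderivative j (pderivative i u) y = pderivative i (pderivative j u) z"
    using t(1) by simp
  moreover have "dist (pderivative j (pderivative i u) y) (pderivative j (pderivative i u) x) < e"
    "dist (pderivative i (pderivative j u) z) (pderivative i (pderivative j u) x) < e"
    using y(1) z(1) t by (auto intro!: d(2) simp: dist_commute[of x])
  ultimately show False
    unfolding e_def dist_real_def by argo
qed

section \<open>Self-adjoint endomorphisms\<close>

lemma invertible_of_pos_def:
  fixes G :: "real^'n^'n"
  assumes "\<And>x. x \<noteq> 0 \<Longrightarrow> x \<bullet> (G *v x) > 0"
  shows "invertible G"
proof -
  have "inj ((*v) G)"
    using assms by (intro linear_injective_0[THEN iffD2]) (auto, fastforce)
  then show ?thesis
    by (simp add: invertible_left_inverse matrix_left_invertible_injective)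
qed

lemma inner_mult_symmetric:
  fixes M :: "real^'n^'n"
  assumes "transpose M = M"
  shows "x \<bullet> (M *v y) = (M *v x) \<bullet> y"
  using dot_lmul_matrix[of x M y] transpose_matrix_vector[of M x] assms by simp

text \<open>The first-order condition at a maximum: for small t with the sign of a, the linear term
  would dominate.\<close>

lemma linear_coefficient_zero:
  fixes a b :: real
  assumes "\<And>t. 2 * t * a + t\<^sup>2 * b \<le> 0"
  shows "a = 0"
proof (rule ccontr)
  assume a: "a \<noteq> 0"
  \<comment> \<open>The test value is t = a / d, where the expression equals a^2 (2d + b) / d^2;
    this \<open>d\<close> makes 2d + b positive for either sign of b.\<close>
  define d where "d = 1 + \<bar>b\<bar>"
  have d: "d > 0" "2 * d + b > 0" by (auto simp: d_def)
  have "2 * (a / d) * a + (a / d)\<^sup>2 * b = a\<^sup>2 * (2 * d + b) / d\<^sup>2"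
    using d by (simp add: power2_eq_square field_simps)
  moreover have "\<dots> > 0"
    using a d by simp
  ultimately show False using assms[of "a / d"] by linarith
qed

text \<open>The eigenvector maximizes the Rayleigh quotient.\<close>

lemma self_adjoint_eigenvector:
  fixes G T :: "real^'n^'n"
  assumes G: "transpose G = G" "\<And>x. x \<noteq> 0 \<Longrightarrow> x \<bullet> (G *v x) > 0"
    and T: "transpose (G ** T) = G ** T"
    and V: "subspace V" "V \<noteq> {0}" "\<And>x. x \<in> V \<Longrightarrow> T *v x \<in> V"
  obtains x \<mu> where "x \<in> V" "x \<noteq> 0" "T *v x = \<mu> *\<^sub>R x"
proof -
  define H where "H = G ** T"
  define r where "r x = (x \<bullet> (H *v x)) / (x \<bullet> (G *v x))" for x
  \<comment> \<open>The Euclidean sphere is used although the quotient is formed with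
    \<open>G\<close>: it is compact, and \<open>r\<close> is invariant under scaling, so a maximum
    on it is a maximum over all non-zero vectors of \<open>V\<close>.\<close>
  let ?K = "V \<inter> sphere 0 1"
  have scale: "(1 / norm y) *\<^sub>R y \<in> ?K" if "y \<in> V" "y \<noteq> 0" for y
    using that subspace_scale[OF V(1) that(1), of "1 / norm y"] by simp
  have "\<exists>y\<in>V. y \<noteq> 0"
    using V(2) subspace_0[OF V(1)] by auto
  then have "?K \<noteq> {}" using scale by blast
  moreover have "compact ?K"
    by (rule closed_Int_compact[OF closed_subspace[OF V(1)] compact_sphere])
  moreover have "continuous_on ?K r"
  proof -
    have "x \<bullet> (G *v x) \<noteq> 0" if "x \<in> ?K" for x
      using that G(2)[of x] by (cases "x = 0") simp_all
    moreover have "continuous_on ?K (\<lambda>x. x \<bullet> (M *v x))" for M :: "real^'n^'n"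
      by (intro continuous_on_inner continuous_on_id linear_continuous_on
          matrix_vector_mul_bounded_linear)
    ultimately show ?thesis
      unfolding r_def by (intro continuous_on_divide) simp_all
  qed
  ultimately have "\<exists>x\<in>?K. \<forall>y\<in>?K. r y \<le> r x"
    by (intro continuous_attains_sup)
  then obtain x where x: "x \<in> ?K" "\<And>y. y \<in> ?K \<Longrightarrow> r y \<le> r x"
    by metis
  then have x0: "x \<noteq> 0" "x \<in> V" by auto
  define \<mu> where "\<mu> = r x"
  \<comment> \<open>Maximality says that this symmetric form is non-positive on \<open>V\<close> and
    vanishes at \<open>x\<close>; its first variation at \<open>x\<close> then vanishes in every
    direction of \<open>V\<close>, which is \<open>orth\<close>.\<close>
  define M where "M = H - \<mu> *\<^sub>R G"
  have Mv: "M *v z = H *v z - \<mu> *\<^sub>R (G *v z)" for z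
    by (simp add: M_def matrix_vector_mult_diff_rdistrib scaleR_matrix_vector_assoc)
  have M_sym: "z \<bullet> (M *v y) = (M *v z) \<bullet> y" for y z
    unfolding Mv using inner_mult_symmetric[OF G(1), of z y] inner_mult_symmetric[OF T, of z y]
    by (simp add: H_def inner_diff_left inner_diff_right)
  have r_le: "r y \<le> \<mu>" if "y \<in> V" "y \<noteq> 0" for y
  proof -
    have "r ((1 / norm y) *\<^sub>R y) = r y"
      using that(2) by (simp add: r_def matrix_vector_mult_scaleR)
    then show ?thesis using x(2)[OF scale[OF that]] by (simp add: \<mu>_def)
  qed
  have M_neg: "y \<bullet> (M *v y) \<le> 0" if "y \<in> V" for y
  proof (cases "y = 0")
    case False
    then show ?thesis
      using r_le[OF that False] G(2)[OF False]
      by (simp add: r_def Mv inner_diff_right divide_le_eq)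
  qed simp
  have M_x: "x \<bullet> (M *v x) = 0"
    using G(2)[OF x0(1)] by (simp add: Mv inner_diff_right \<mu>_def r_def)
  have orth: "y \<bullet> (M *v x) = 0" if "y \<in> V" for y
  proof (rule linear_coefficient_zero)
    fix t :: real
    have "(x + t *\<^sub>R y) \<bullet> (M *v (x + t *\<^sub>R y)) \<le> 0"
      using that x0 V(1) by (intro M_neg) (simp add: subspace_add subspace_scale)
    moreover have "x \<bullet> (M *v y) = y \<bullet> (M *v x)"
      using M_sym[of x y] inner_commute[of "M *v x" y] by simp
    ultimately show "2 * t * (y \<bullet> (M *v x)) + t\<^sup>2 * (y \<bullet> (M *v y)) \<le> 0"
      using M_x by (simp add: matrix_vector_right_distrib matrix_vector_mult_scaleR
          inner_add_left inner_add_right power2_eq_square algebra_simps)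
  qed
  \<comment> \<open>Invariance of \<open>V\<close> puts the defect Tx - mu x back into
    \<open>V\<close>, so \<open>orth\<close> may be tested on the defect itself, and positivity of
    \<open>G\<close> forces it to be zero.\<close>
  have "M *v x = G *v (T *v x - \<mu> *\<^sub>R x)"
    by (simp add: Mv H_def matrix_vector_mult_diff_distrib matrix_vector_mult_scaleR
        matrix_vector_mul_assoc)
  moreover have "T *v x - \<mu> *\<^sub>R x \<in> V"
    using x0 V by (simp add: subspace_diff subspace_scale)
  ultimately have "T *v x - \<mu> *\<^sub>R x = 0"
    using orth[of "T *v x - \<mu> *\<^sub>R x"] G(2)[of "T *v x - \<mu> *\<^sub>R x"] by auto
  then show thesis using that[of x \<mu>] x0 by simp
qed

text \<open>Self-adjointness makes the \<open>G\<close>-orthogonal complement of the eigenvectors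
  invariant under \<open>T\<close>. If it were non-zero, it would contain an eigenvector, which
  would be \<open>G\<close>-orthogonal to itself.\<close>

lemma span_eigenvectors:
  fixes G T :: "real^'n^'n"
  assumes G: "transpose G = G" "\<And>x. x \<noteq> 0 \<Longrightarrow> x \<bullet> (G *v x) > 0"
    and T: "transpose (G ** T) = G ** T"
  shows "span {x. \<exists>\<mu>. T *v x = \<mu> *\<^sub>R x} = UNIV" (is "span ?E = UNIV")
proof (rule ccontr)
  assume ne: "span ?E \<noteq> UNIV"
  define V where "V = {y. \<forall>x\<in>span ?E. x \<bullet> (G *v y) = 0}"
  have "subspace V"
    by (auto simp: V_def subspace_def matrix_vector_right_distrib matrix_vector_mult_scaleR
        inner_add_right)
  have inv: "T *v y \<in> V" if "y \<in> V" for y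
  proof -
    have "x \<bullet> (G *v (T *v y)) = 0" if x: "x \<in> span ?E" for x
    proof -
      have "T *v x \<in> span ?E"
        using x
      proof (induction rule: span_induct_alt)
        case (step c e z)
        then obtain \<mu> where "T *v e = \<mu> *\<^sub>R e" by blast
        then show ?case
          using step span_base[of e ?E] unfolding matrix_vector_right_distrib matrix_vector_mult_scaleR
          by (simp add: span_add span_scale)
      qed (simp add: span_zero)
      moreover have "x \<bullet> (G *v (T *v y)) = (T *v x) \<bullet> (G *v y)"
        using inner_mult_symmetric[OF T, of x y] inner_mult_symmetric[OF G(1), of "T *v x" y]
        by (simp add: matrix_vector_mul_assoc)
      ultimately show ?thesis using \<open>y \<in> V\<close> by (simp add: V_def)
    qed
    then show ?thesis by (simp add: V_def)
  qed
  have "span ?E \<subset> span UNIV" using ne by auto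
  then obtain z where z: "z \<noteq> 0" "\<And>y. y \<in> span ?E \<Longrightarrow> orthogonal z y"
    using orthogonal_to_subspace_exists_gen[of ?E UNIV] by auto
  \<comment> \<open>\<open>z\<close> is orthogonal to the eigenvectors in the Euclidean sense; the
    inverse of \<open>G\<close> turns it into a non-zero vector that is \<open>G\<close>-orthogonal
    to them.\<close>
  obtain G' where "G ** G' = mat 1"
    using invertible_of_pos_def[OF G(2)] by (auto simp: invertible_def)
  then have Gz: "G *v (G' *v z) = z"
    by (simp add: matrix_vector_mul_assoc)
  then have "G' *v z \<in> V"
    using z(2) by (simp add: V_def orthogonal_def inner_commute)
  moreover have "G' *v z \<noteq> 0" using Gz z(1) by auto
  ultimately have "V \<noteq> {0}" by auto
  then obtain x \<mu> where x: "x \<in> V" "x \<noteq> 0" "T *v x = \<mu> *\<^sub>R x"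
    using self_adjoint_eigenvector[OF G T \<open>subspace V\<close> _ inv] by blast
  then have "x \<in> span ?E" by (intro span_base) auto
  then have "x \<bullet> (G *v x) = 0" using x(1) by (simp add: V_def)
  then show False using G(2)[OF x(2)] by simp
qed

text \<open>A maximal independent set of eigenvectors is a basis because eigenvectors span. It is
  indexed by the coordinate type itself so that it can form the columns of a square matrix.\<close>

lemma self_adjoint_diagonalizable:
  fixes G T :: "real^'n^'n"
  assumes G: "transpose G = G" "\<And>x. x \<noteq> 0 \<Longrightarrow> x \<bullet> (G *v x) > 0"
    and T: "transpose (G ** T) = G ** T"
  shows "\<exists>(f :: 'n \<Rightarrow> real^'n) ev. inj f \<and> independent (range f) \<and> span (range f) = UNIV
    \<and> (\<forall>i. T *v f i = ev i *\<^sub>R f i)"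
proof -
  let ?E = "{x. \<exists>\<mu>. T *v x = \<mu> *\<^sub>R x}"
  obtain B where B: "B \<subseteq> ?E" "independent B" "?E \<subseteq> span B"
    using maximal_independent_subset[of ?E] by blast
  have "span ?E = UNIV" by (rule span_eigenvectors) (use G T in auto)
  then have span: "span B = UNIV"
    using span_minimal[OF B(3) subspace_span] by blast
  have "finite B" using B(2) independent_imp_finite by blast
  moreover have "card B = CARD('n)"
    using dim_eq_card_independent[OF B(2)] dim_span[of B] span by simp
  ultimately obtain f where f: "bij_betw f (UNIV :: 'n set) B"
    using finite_same_card_bij[of "UNIV :: 'n set" B] by auto
  then have "\<forall>i. \<exists>\<mu>. T *v f i = \<mu> *\<^sub>R f i"
    using B(1) by (auto simp: bij_betw_def)
  then obtain ev where "\<And>i. T *v f i = ev i *\<^sub>R f i" by metis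
  then show ?thesis
    using f B(2) span by (intro exI[of _ f] exI[of _ ev]) (simp add: bij_betw_def)
qed

text \<open>Conjugation by the basis matrix makes \<open>T\<close> diagonal: traces are invariant
  under it, and eigenspaces become coordinate subspaces, whose dimensions are counted by
  indices.\<close>

lemma eigenvalues_of_eigenbasis:
  fixes T :: "real^'n^'n" and f :: "'n \<Rightarrow> real^'n" and ev :: "'n \<Rightarrow> real"
  assumes f: "inj f" "independent (range f)" "span (range f) = UNIV"
    and ev: "\<And>i. T *v f i = ev i *\<^sub>R f i"
  shows "eigenvalues T = range ev"
    and "num_nonzero_eigenvalues T = card {i. ev i \<noteq> 0}"
    and "trace T = (\<Sum>i\<in>UNIV. ev i)"
    and "trace (T ** T) = (\<Sum>i\<in>UNIV. (ev i)\<^sup>2)"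
proof -
  define P :: "real^'n^'n" where "P = (\<chi> i j. f j $ i)"
  define D :: "real^'n^'n" where "D = (\<chi> i j. if i = j then ev i else 0)"
  have P_vec: "P *v z = (\<Sum>i\<in>UNIV. z $ i *\<^sub>R f i)" for z
    by (simp add: P_def matrix_vector_mult_def vec_eq_iff mult.commute)
  have D_vec: "(D *v z) $ i = ev i * z $ i" for z i
    by (simp add: D_def matrix_vector_mult_def if_distrib[of "\<lambda>a. a * b" for b] cong: if_cong)
  have TP: "T ** P = P ** D"
  proof -
    have "(T ** P) $ i $ j = (T *v f j) $ i" "(P ** D) $ i $ j = f j $ i * ev j" for i j
      by (simp_all add: P_def D_def matrix_matrix_mult_def matrix_vector_mult_def
          if_distrib[of "\<lambda>a. b * a" for b] cong: if_cong)
    then show ?thesis by (simp add: vec_eq_iff ev)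
  qed
  have "columns P = range f"
    by (auto simp: columns_def column_def P_def)
  then obtain P' where P1: "P ** P' = mat 1"
    using f(3) matrix_right_invertible_span_columns[of P] by (auto simp: span_vec_eq)
  then have P2: "P' ** P = mat 1" using matrix_left_right_inverse by blast
  have T_eq: "T = P ** D ** P'"
    using arg_cong[OF TP, of "\<lambda>M. M ** P'"] P1 by (simp add: matrix_mul_assoc[symmetric])
  have tr_conj: "trace (P ** M ** P') = trace M" for M
    using trace_mul_sym[of "P ** M" P'] by (simp add: matrix_mul_assoc P2)
  show "trace T = (\<Sum>i\<in>UNIV. ev i)"
    unfolding T_eq tr_conj by (simp add: trace_def D_def)
  have "T ** T = P ** D ** (P' ** P) ** D ** P'"
    unfolding T_eq by (simp only: matrix_mul_assoc)
  then have "T ** T = P ** (D ** D) ** P'"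
    by (simp add: P2 matrix_mul_assoc)
  moreover have "trace (D ** D) = (\<Sum>i\<in>UNIV. (ev i)\<^sup>2)"
    by (simp add: trace_def D_def matrix_matrix_mult_def power2_eq_square
        if_distrib[of "\<lambda>a. a * b" for b] if_distrib[of "\<lambda>a. b * a" for b] cong: if_cong)
  ultimately show "trace (T ** T) = (\<Sum>i\<in>UNIV. (ev i)\<^sup>2)"
    by (simp add: tr_conj)
  \<comment> \<open>\<open>P'\<close> gives coordinates in the eigenbasis, on which \<open>T\<close>
    acts diagonally. An eigenvector thus involves only basis vectors with its own eigenvalue, which
    settles both the spectrum and the eigenspace dimensions.\<close>
  have eig_coord: "(P' *v x) $ i = 0" if "T *v x = \<mu> *\<^sub>R x" "ev i \<noteq> \<mu>" for x \<mu> i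
  proof -
    have "P' ** T = D ** P'"
      unfolding T_eq by (simp add: matrix_mul_assoc P2)
    then have "D *v (P' *v x) = P' *v (T *v x)"
      by (simp add: matrix_vector_mul_assoc)
    also have "\<dots> = \<mu> *\<^sub>R (P' *v x)"
      by (simp add: that(1) matrix_vector_mult_scaleR)
    finally have "(D *v (P' *v x)) $ i = (\<mu> *\<^sub>R (P' *v x)) $ i"
      by simp
    then have "ev i * (P' *v x) $ i = \<mu> * (P' *v x) $ i"
      unfolding D_vec by simp
    then show ?thesis using that(2) by simp
  qed
  have x_eq: "x = (\<Sum>i\<in>UNIV. (P' *v x) $ i *\<^sub>R f i)" for x
    unfolding P_vec[symmetric] by (simp add: matrix_vector_mul_assoc P1)
  have f_nz: "f i \<noteq> 0" for i
    using f(2) dependent_zero[of "range f"] rangeI[of f i] by auto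
  show eigs: "eigenvalues T = range ev"
  proof (intro equalityI subsetI)
    fix \<mu> assume "\<mu> \<in> eigenvalues T"
    then obtain x where x: "x \<noteq> 0" "T *v x = \<mu> *\<^sub>R x"
      by (auto simp: eigenvalues_def)
    show "\<mu> \<in> range ev"
    proof (rule ccontr)
      assume "\<mu> \<notin> range ev"
      then have "(P' *v x) $ i = 0" for i
        using eig_coord[OF x(2), of i] rangeI[of ev i] by (cases "ev i = \<mu>") auto
      then show False using x_eq[of x] x(1) by simp
    qed
  next
    fix \<mu> assume "\<mu> \<in> range ev"
    then show "\<mu> \<in> eigenvalues T"
      using f_nz ev by (auto simp: eigenvalues_def)
  qed
  have dim: "dim {x. T *v x = \<mu> *\<^sub>R x} = card {i. ev i = \<mu>}" for \<mu>
  proof (rule dim_unique)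
    show "f ` {i. ev i = \<mu>} \<subseteq> {x. T *v x = \<mu> *\<^sub>R x}" by (auto simp: ev)
    show "independent (f ` {i. ev i = \<mu>})"
      by (rule independent_mono[OF f(2)]) auto
    show "card (f ` {i. ev i = \<mu>}) = card {i. ev i = \<mu>}"
      by (rule card_image[OF inj_on_subset[OF f(1) subset_UNIV]])
    show "{x. T *v x = \<mu> *\<^sub>R x} \<subseteq> span (f ` {i. ev i = \<mu>})"
    proof
      fix x assume "x \<in> {x. T *v x = \<mu> *\<^sub>R x}"
      then have x: "T *v x = \<mu> *\<^sub>R x" by simp
      have "(P' *v x) $ i *\<^sub>R f i \<in> span (f ` {i. ev i = \<mu>})" for i
        using eig_coord[OF x, of i] by (cases "ev i = \<mu>") (auto intro: span_scale span_base span_zero)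
      then have "(\<Sum>i\<in>UNIV. (P' *v x) $ i *\<^sub>R f i) \<in> span (f ` {i. ev i = \<mu>})"
        by (intro span_sum)
      then show "x \<in> span (f ` {i. ev i = \<mu>})"
        using x_eq[of x] by simp
    qed
  qed
  \<comment> \<open>Counting the indices by the value of \<open>ev\<close> turns the cardinality
    into the sum over distinct eigenvalues used in the definition.\<close>
  have "card {i. ev i \<noteq> 0} = (\<Sum>\<mu>\<in>ev ` {i. ev i \<noteq> 0}. card {i \<in> {i. ev i \<noteq> 0}. ev i = \<mu>})"
    using sum.image_gen[of "{i. ev i \<noteq> 0}" "\<lambda>_. 1 :: nat" ev] by simp
  also have "\<dots> = (\<Sum>\<mu>\<in>range ev - {0}. card {i. ev i = \<mu>})"
    by (rule sum.cong) (auto intro!: arg_cong[of _ _ card])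
  finally show "num_nonzero_eigenvalues T = card {i. ev i \<noteq> 0}"
    by (simp add: num_nonzero_eigenvalues_def eigs dim)
qed

text \<open>The deviations from the mean, multiplied by m to avoid a division. This one identity
  yields Cauchy-Schwarz against the constant vector and, as a sum of squares vanishes only termwise,
  its equality case too.\<close>

lemma sum_squared_deviations:
  fixes a :: "'i \<Rightarrow> real"
  assumes "finite S"
  defines "m \<equiv> real (card S)" and "s \<equiv> sum a S"
  shows "(\<Sum>i\<in>S. (m * a i - s)\<^sup>2) = m * (m * (\<Sum>i\<in>S. (a i)\<^sup>2) - s\<^sup>2)"
proof -
  have "(\<Sum>i\<in>S. (m * a i - s)\<^sup>2) = (\<Sum>i\<in>S. m\<^sup>2 * (a i)\<^sup>2 - 2 * m * s * a i + s\<^sup>2)"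
    by (simp add: power2_eq_square algebra_simps)
  also have "\<dots> = m\<^sup>2 * (\<Sum>i\<in>S. (a i)\<^sup>2) - 2 * m * s * s + m * s\<^sup>2"
    by (simp add: sum.distrib sum_subtractf sum_distrib_left s_def m_def)
  finally show ?thesis by (simp add: power2_eq_square algebra_simps)
qed

lemma trace_square_ge:
  fixes G T :: "real^'n^'n"
  assumes G: "transpose G = G" "\<And>x. x \<noteq> 0 \<Longrightarrow> x \<bullet> (G *v x) > 0"
    and T: "transpose (G ** T) = G ** T"
    and m: "num_nonzero_eigenvalues T = m" "m > 0"
  shows "(trace T)\<^sup>2 / real m \<le> trace (T ** T)"
    and "(trace T)\<^sup>2 / real m = trace (T ** T) \<longleftrightarrow>
      (\<forall>\<mu>\<in>eigenvalues T - {0}. \<forall>\<nu>\<in>eigenvalues T - {0}. \<mu> = \<nu>)"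
proof -
  obtain f :: "'n \<Rightarrow> real^'n" and ev where f: "inj f" "independent (range f)" "span (range f) = UNIV"
    and "\<forall>i. T *v f i = ev i *\<^sub>R f i"
  proof -
    have "\<exists>(f :: 'n \<Rightarrow> real^'n) ev. inj f \<and> independent (range f) \<and> span (range f) = UNIV
        \<and> (\<forall>i. T *v f i = ev i *\<^sub>R f i)"
      by (rule self_adjoint_diagonalizable[where G = G]) (fact G T)+
    then show thesis by (elim exE conjE) (rule that)
  qed
  then have ev: "\<And>i. T *v f i = ev i *\<^sub>R f i" by simp
  note * = eigenvalues_of_eigenbasis[OF f ev]
  \<comment> \<open>Zero eigenvalues contribute to neither trace, so both sums run over m indices;
    hence the constant 1/m instead of 1/n.\<close>
  define S where "S = {i. ev i \<noteq> 0}"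
  define s where "s = sum ev S"
  have card: "card S = m" using *(2) m by (simp add: S_def)
  have tr: "trace T = s" "trace (T ** T) = (\<Sum>i\<in>S. (ev i)\<^sup>2)"
    unfolding *(3,4) s_def S_def by (rule sum.mono_neutral_right; auto)+
  have dev: "(\<Sum>i\<in>S. (m * ev i - s)\<^sup>2) = m * (m * trace (T ** T) - (trace T)\<^sup>2)"
    unfolding tr using sum_squared_deviations[of S ev] by (simp add: card s_def)
  moreover have "(\<Sum>i\<in>S. (m * ev i - s)\<^sup>2) \<ge> 0"
    by (intro sum_nonneg) simp
  ultimately have "m * trace (T ** T) - (trace T)\<^sup>2 \<ge> 0"
    using m(2) by (simp add: zero_le_mult_iff)
  then show "(trace T)\<^sup>2 / real m \<le> trace (T ** T)"
    using m(2) by (simp add: divide_le_eq mult.commute)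
  have "(trace T)\<^sup>2 / real m = trace (T ** T) \<longleftrightarrow> (\<Sum>i\<in>S. (m * ev i - s)\<^sup>2) = 0"
    using m(2) by (auto simp: dev divide_eq_eq mult.commute)
  also have "\<dots> \<longleftrightarrow> (\<forall>i\<in>S. m * ev i = s)"
    by (subst sum_nonneg_eq_0_iff) auto
  also have "\<dots> \<longleftrightarrow> (\<forall>i\<in>S. \<forall>j\<in>S. ev i = ev j)"
  proof
    assume "\<forall>i\<in>S. real m * ev i = s"
    then have "ev i = s / m" if "i \<in> S" for i
      using that m(2) by (simp add: eq_divide_eq mult.commute)
    then show "\<forall>i\<in>S. \<forall>j\<in>S. ev i = ev j" by simp
  next
    assume eq: "\<forall>i\<in>S. \<forall>j\<in>S. ev i = ev j"
    show "\<forall>i\<in>S. real m * ev i = s"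
    proof
      fix i assume "i \<in> S"
      then have "s = (\<Sum>j\<in>S. ev i)" unfolding s_def using eq by (intro sum.cong) blast+
      then show "real m * ev i = s" by (simp add: card)
    qed
  qed
  also have "\<dots> \<longleftrightarrow> (\<forall>\<mu>\<in>eigenvalues T - {0}. \<forall>\<nu>\<in>eigenvalues T - {0}. \<mu> = \<nu>)"
    unfolding *(1) S_def by blast
  finally show "(trace T)\<^sup>2 / real m = trace (T ** T) \<longleftrightarrow>
      (\<forall>\<mu>\<in>eigenvalues T - {0}. \<forall>\<nu>\<in>eigenvalues T - {0}. \<mu> = \<nu>)" .
qed

section \<open>Coordinate vector fields as derivations\<close>

text \<open>\<open>W\<close> stands for the neighbourhood on which \<open>h\<close> is regular. All
  regularity is measured on its part \<open>U\<close> inside the chart domain, so that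
  \<open>h\<close>, \<open>f\<close> and the metric share one predicate \<open>C\<close>.\<close>

locale chart_region =
  fixes X :: "'a topology" and c :: "('a, 'n::finite) chart" and W :: "'a set"
  assumes is_chart: "is_chart X c" and open_W: "openin X W"
begin

definition U :: "'a set" where "U = fst c \<inter> W"

abbreviation C :: "nat \<Rightarrow> ('a \<Rightarrow> real) \<Rightarrow> bool" where
  "C k u \<equiv> Ck_in_chart k c W u"

lemma open_image: "open (snd c ` U)"
proof -
  have "openin X (fst c)" "open (snd c ` fst c)"
    and hom: "homeomorphic_map (subtopology X (fst c)) (top_of_set (snd c ` fst c)) (snd c)"
    using is_chart by (auto simp: is_chart_def)
  then have "openin (subtopology X (fst c)) U"
    using open_W by (auto simp: U_def openin_subtopology)
  then have "openin (top_of_set (snd c ` fst c)) (snd c ` U)"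
    using homeomorphic_imp_open_map[OF hom] by (auto simp: open_map_def)
  then show ?thesis using \<open>open (snd c ` fst c)\<close> openin_open_eq by blast
qed

lemma inj_chart: "inj_on (snd c) (fst c)"
proof -
  have "openin X (fst c)"
    and hom: "homeomorphic_map (subtopology X (fst c)) (top_of_set (snd c ` fst c)) (snd c)"
    using is_chart by (auto simp: is_chart_def)
  then have "topspace (subtopology X (fst c)) = fst c"
    using openin_subset by fastforce
  then show ?thesis using homeomorphic_imp_injective_map[OF hom] by simp
qed

lemma chart_inv_chart: "q \<in> U \<Longrightarrow> chart_inv c (snd c q) = q"
  using inj_chart by (simp add: chart_inv_def U_def)

lemma chart_chart_inv: "y \<in> snd c ` U \<Longrightarrow> snd c (chart_inv c y) = y"
  by (auto simp: chart_inv_chart)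

lemma chart_inv_in_U: "y \<in> snd c ` U \<Longrightarrow> chart_inv c y \<in> U"
  by (auto simp: chart_inv_chart)

lemma C_iff: "C k u \<longleftrightarrow> Ck_on k (snd c ` U) (\<lambda>y. u (chart_inv c y))"
  by (simp add: Ck_in_chart_def U_def comp_def)

lemma C_cong: "(\<And>q. q \<in> U \<Longrightarrow> u q = w q) \<Longrightarrow> C k u \<longleftrightarrow> C k w"
  unfolding C_iff by (rule Ck_on_cong[OF open_image]) (simp add: chart_inv_in_U)

lemma C_le: "C l u \<Longrightarrow> k \<le> l \<Longrightarrow> C k u"
  using Ck_on_le by (auto simp: C_iff)

lemma C_const: "C k (\<lambda>q. a)"
  by (simp add: C_iff Ck_on_const)

lemma C_add: "C k u \<Longrightarrow> C k w \<Longrightarrow> C k (\<lambda>q. u q + w q)"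
  using Ck_on_add[OF open_image] by (simp add: C_iff)

lemma C_mult: "C k u \<Longrightarrow> C k w \<Longrightarrow> C k (\<lambda>q. u q * w q)"
  using Ck_on_mult[OF open_image] by (simp add: C_iff)

lemma C_diff:
  assumes "C k u" "C k w"
  shows "C k (\<lambda>q. u q - w q)"
  using C_add[OF assms(1) C_mult[OF C_const[of k "- 1"] assms(2)]] by simp

lemma C_divide_const: "C k u \<Longrightarrow> C k (\<lambda>q. u q / a)"
  using C_mult[OF _ C_const[of k "inverse a"]] by (simp add: divide_inverse)

lemma C_sum: "(\<And>a. a \<in> I \<Longrightarrow> C k (u a)) \<Longrightarrow> C k (\<lambda>q. \<Sum>a\<in>I. u a q)"
  using Ck_on_sum[OF open_image, of I k "\<lambda>a y. u a (chart_inv c y)"] by (simp add: C_iff)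

lemma C_exp: "C k u \<Longrightarrow> C k (\<lambda>q. exp (u q))"
  using Ck_on_exp[OF open_image] by (simp add: C_iff)

lemma C_matrix_inv:
  fixes M :: "'a \<Rightarrow> real^'m^'m"
  assumes "\<And>i j. C k (\<lambda>q. M q $ i $ j)" "\<And>q. q \<in> U \<Longrightarrow> det (M q) \<noteq> 0"
  shows "C k (\<lambda>q. matrix_inv (M q) $ i $ j)"
  using Ck_on_matrix_inv[OF open_image, of k "\<lambda>y. M (chart_inv c y)"] assms
  by (simp add: C_iff chart_inv_in_U)

lemma C_cpd:
  assumes "C (Suc k) u"
  shows "C k (cpd c i u)"
proof -
  have "Ck_on k (snd c ` U) (pderivative i (\<lambda>y. u (chart_inv c y)))"
    using assms by (simp add: C_iff)
  then show ?thesis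
    unfolding C_iff cpd_def comp_def
    by (subst Ck_on_cong[OF open_image]) (simp_all add: chart_chart_inv)
qed

lemma cpd_cong:
  assumes "q \<in> U" "\<And>r. r \<in> U \<Longrightarrow> u r = w r"
  shows "cpd c i u q = cpd c i w q"
  unfolding cpd_def
  by (rule pderivative_cong_open[OF open_image]) (use assms chart_inv_in_U in auto)

lemma C_differentiable:
  assumes "q \<in> U" "C k u" "k > 0"
  shows "(\<lambda>y. u (chart_inv c y)) differentiable (at (snd c q))"
  using assms Ck_on_differentiable[of k "snd c ` U" "\<lambda>y. u (chart_inv c y)" "snd c q"] by (auto simp: C_iff)

lemma cpd_const: "cpd c i (\<lambda>q. a) q = 0"
  by (simp add: cpd_def comp_def pderivative_const)

lemma cpd_add:
  assumes "q \<in> U" "C 1 u" "C 1 w"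
  shows "cpd c i (\<lambda>r. u r + w r) q = cpd c i u q + cpd c i w q"
  unfolding cpd_def comp_def
  using assms C_differentiable[of q 1] by (intro pderivative_add) auto

lemma cpd_mult:
  assumes "q \<in> U" "C 1 u" "C 1 w"
  shows "cpd c i (\<lambda>r. u r * w r) q = u q * cpd c i w q + cpd c i u q * w q"
  unfolding cpd_def comp_def
  using assms C_differentiable[of q 1] by (subst pderivative_mult) (auto simp: chart_inv_chart)

lemma cpd_diff:
  assumes "q \<in> U" "C 1 u" "C 1 w"
  shows "cpd c i (\<lambda>r. u r - w r) q = cpd c i u q - cpd c i w q"
  using cpd_add[OF assms(1,2) C_mult[OF C_const assms(3), of "- 1"]]
    cpd_mult[OF assms(1) C_const assms(3), of i "- 1"]
  by (simp add: cpd_const)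

lemma cpd_divide_const:
  assumes "q \<in> U" "C 1 u"
  shows "cpd c i (\<lambda>r. u r / a) q = cpd c i u q / a"
  using cpd_mult[OF assms C_const, of i "inverse a"] by (simp add: cpd_const divide_inverse)

lemma cpd_sum:
  assumes "q \<in> U" "\<And>a. a \<in> I \<Longrightarrow> C 1 (u a)"
  shows "cpd c i (\<lambda>r. \<Sum>a\<in>I. u a r) q = (\<Sum>a\<in>I. cpd c i (u a) q)"
  using assms(2)
proof (induction I rule: infinite_finite_induct)
  case (insert a I)
  then show ?case using cpd_add[OF assms(1), of "u a" "\<lambda>r. \<Sum>a\<in>I. u a r"] C_sum[of I 1 u] by simp
qed (simp_all add: cpd_const)

lemma cpd_exp:
  assumes "q \<in> U" "C 1 u"
  shows "cpd c i (\<lambda>r. exp (u r)) q = exp (u q) * cpd c i u q"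
  unfolding cpd_def comp_def
  using assms C_differentiable[of q 1] by (subst pderivative_exp) (auto simp: chart_inv_chart)

lemma cpd_commute:
  assumes "q \<in> U" "C 2 u"
  shows "cpd c i (cpd c j u) q = cpd c j (cpd c i u) q"
proof -
  let ?u = "\<lambda>y. u (chart_inv c y)"
  have "cpd c i (cpd c j u) q = pderivative i (pderivative j ?u) (snd c q)" for i j
    unfolding cpd_def comp_def
    using assms(1) chart_chart_inv
    by (intro pderivative_cong_open[OF open_image]) auto
  then show ?thesis
    using pderivative_commute[OF open_image, of ?u "snd c q" i j] assms by (simp add: C_iff)
qed

end

section \<open>The Levi-Civita connection in a chart\<close>

lemma matrix_mult_uminus_left: "(- A) ** (B :: real^'p^'n) = - (A ** B)"
  by (simp add: matrix_matrix_mult_def vec_eq_iff sum_negf)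

lemma matrix_vector_mult_uminus: "(- A) *v x = - (A *v (x :: real^'n))"
  by (simp add: matrix_vector_mult_def vec_eq_iff sum_negf)

lemma matrix_add_rdistrib': "(A + B) ** (D :: real^'p^'n) = A ** D + B ** D"
  by (simp add: matrix_matrix_mult_def vec_eq_iff sum.distrib algebra_simps)

locale chart_metric = chart_region X c W
  for X :: "'a topology" and c :: "('a, 'n::finite) chart" and W :: "'a set" +
  fixes g :: "('a, 'n) chart \<Rightarrow> 'a \<Rightarrow> real^'n^'n"
  assumes metric_C: "\<And>k i j. C k (\<lambda>q. g c q $ i $ j)"
    and metric_sym: "\<And>q. q \<in> U \<Longrightarrow> transpose (g c q) = g c q"
    and metric_pos: "\<And>q \<xi>. q \<in> U \<Longrightarrow> \<xi> \<noteq> 0 \<Longrightarrow> \<xi> \<bullet> (g c q *v \<xi>) > 0"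
begin

abbreviation gi :: "'a \<Rightarrow> real^'n^'n" where
  "gi q \<equiv> matrix_inv (g c q)"

text \<open>The endomorphism by which the covariant derivative along the j-th coordinate field differs
  from the coordinate derivative of the components of a vector field.\<close>

definition conn :: "'n \<Rightarrow> 'a \<Rightarrow> real^'n^'n" where
  "conn j q = (\<chi> l s. christoffel g c l j s q)"

definition cpd_metric :: "'n \<Rightarrow> 'a \<Rightarrow> real^'n^'n" where
  "cpd_metric k q = (\<chi> i j. cpd c k (\<lambda>r. g c r $ i $ j) q)"

lemma metric_det:
  assumes "q \<in> U"
  shows "det (g c q) \<noteq> 0"
  using invertible_of_pos_def[OF metric_pos[OF assms]] by (simp add: invertible_det_nz)

lemma gi_mul:
  assumes "q \<in> U"
  shows "g c q ** gi q = mat 1" "gi q ** g c q = mat 1"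
  using matrix_inv_mul[OF metric_det[OF assms]] by auto

lemma metric_component_sym: "q \<in> U \<Longrightarrow> g c q $ i $ j = g c q $ j $ i"
  using arg_cong[OF metric_sym, of q "\<lambda>M. M $ j $ i"] by (simp add: transpose_def)

lemma gi_sym:
  assumes "q \<in> U"
  shows "transpose (gi q) = gi q"
proof -
  have "transpose (gi q) ** g c q = mat 1"
    using arg_cong[OF gi_mul(1)[OF assms], of transpose]
    by (simp add: matrix_transpose_mul metric_sym[OF assms] transpose_mat)
  then have "transpose (gi q) ** (g c q ** gi q) = gi q"
    by (simp add: matrix_mul_assoc)
  then show ?thesis by (simp add: gi_mul[OF assms])
qed

lemma gi_C: "C k (\<lambda>q. gi q $ i $ j)"
  by (intro C_matrix_inv metric_C metric_det)

lemma christoffel_C: "C k (christoffel g c l i j)"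
  unfolding christoffel_def
  by (intro C_divide_const C_sum C_mult gi_C C_diff C_add C_cpd metric_C)

lemma christoffel_sym:
  assumes "q \<in> U"
  shows "christoffel g c l i j q = christoffel g c l j i q"
proof -
  have "cpd c k (\<lambda>r. g c r $ i $ j) q = cpd c k (\<lambda>r. g c r $ j $ i) q" for k
    by (rule cpd_cong[OF assms metric_component_sym])
  then show ?thesis unfolding christoffel_def by (simp add: add.commute)
qed

text \<open>Lowering the upper index cancels the inverse metric and leaves the Christoffel symbols
  of the first kind.\<close>

lemma metric_conn:
  assumes "q \<in> U"
  shows "(g c q ** conn j q) $ l $ s = (cpd c j (\<lambda>r. g c r $ s $ l) q
    + cpd c s (\<lambda>r. g c r $ j $ l) q - cpd c l (\<lambda>r. g c r $ j $ s) q) / 2"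
proof -
  define D where "D = (\<chi> t s. (cpd c j (\<lambda>r. g c r $ s $ t) q
    + cpd c s (\<lambda>r. g c r $ j $ t) q - cpd c t (\<lambda>r. g c r $ j $ s) q) / 2)"
  have "conn j q = gi q ** D"
    by (simp add: conn_def christoffel_def D_def matrix_matrix_mult_def sum_divide_distrib)
  then have "g c q ** conn j q = D"
    by (simp add: matrix_mul_assoc gi_mul[OF assms])
  then show ?thesis by (simp add: D_def)
qed

text \<open>The metric is parallel: in the sum of a symbol of the first kind and its transpose, the
  terms antisymmetric in the two matrix indices cancel.\<close>

lemma metric_compatible:
  assumes "q \<in> U"
  shows "cpd_metric j q = transpose (conn j q) ** g c q + g c q ** conn j q"
proof -
  have "transpose (conn j q) ** g c q = transpose (g c q ** conn j q)"
    by (simp add: matrix_transpose_mul metric_sym[OF assms])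
  moreover have "cpd c k (\<lambda>r. g c r $ a $ b) q = cpd c k (\<lambda>r. g c r $ b $ a) q" for k a b
    by (rule cpd_cong[OF assms metric_component_sym])
  note sym = this
  ultimately show ?thesis
    by (simp add: vec_eq_iff cpd_metric_def transpose_def metric_conn[OF assms] field_simps)
qed

text \<open>Differentiating \<open>gi q ** g c q = mat 1\<close> and inserting
  \<open>metric_compatible\<close> shows that the inverse metric is parallel too.\<close>

lemma cpd_gi:
  assumes "q \<in> U"
  shows "(\<chi> i l. cpd c j (\<lambda>r. gi r $ i $ l) q)
    = - (gi q ** transpose (conn j q) + conn j q ** gi q)" (is "?D = _")
proof -
  have "?D ** g c q + gi q ** cpd_metric j q = 0"
  proof -
    have "(?D ** g c q + gi q ** cpd_metric j q) $ i $ l = 0" for i l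
    proof -
      have "(?D ** g c q + gi q ** cpd_metric j q) $ i $ l
          = cpd c j (\<lambda>r. \<Sum>k\<in>UNIV. gi r $ i $ k * g c r $ k $ l) q"
        by (simp add: cpd_sum[OF assms] cpd_mult[OF assms] C_mult gi_C metric_C
            matrix_matrix_mult_def cpd_metric_def sum.distrib add.commute)
      also have "\<dots> = cpd c j (\<lambda>r. mat 1 $ i $ l) q"
      proof (rule cpd_cong[OF assms])
        fix r assume "r \<in> U"
        then show "(\<Sum>k\<in>UNIV. gi r $ i $ k * g c r $ k $ l) = mat 1 $ i $ l"
          using gi_mul(2)[of r] by (simp add: matrix_matrix_mult_def vec_eq_iff)
      qed
      finally show ?thesis by (simp add: cpd_const)
    qed
    then show ?thesis by (simp add: vec_eq_iff)
  qed
  then have "?D ** g c q = - (gi q ** cpd_metric j q)"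
    by (simp add: eq_neg_iff_add_eq_0)
  then have "?D ** g c q ** gi q = - (gi q ** cpd_metric j q ** gi q)"
    by (simp add: matrix_mult_uminus_left)
  moreover have "?D ** g c q ** gi q = ?D"
    by (simp add: matrix_mul_assoc[symmetric] gi_mul[OF assms])
  moreover have "gi q ** cpd_metric j q ** gi q
      = gi q ** transpose (conn j q) ** (g c q ** gi q) + (gi q ** g c q) ** conn j q ** gi q"
    by (simp add: metric_compatible[OF assms] matrix_add_ldistrib matrix_add_rdistrib'
        matrix_mul_assoc del: matrix_mul_lid matrix_mul_rid)
  ultimately show ?thesis
    by (simp add: gi_mul[OF assms])
qed

text \<open>The mixed tensor of the covariant derivative of grad u: upper index \<open>l\<close>,
  derivative along the \<open>j\<close>-th coordinate field. Unlike \<open>hess_endo\<close>, this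
  form exposes the derivatives of the gradient components that Bochner's formula needs.\<close>

definition cov :: "('a \<Rightarrow> real) \<Rightarrow> 'n \<Rightarrow> 'n \<Rightarrow> 'a \<Rightarrow> real" where
  "cov u l j q = cpd c j (\<lambda>r. grad g c u r $ l) q
    + (\<Sum>s\<in>UNIV. christoffel g c l j s q * grad g c u q $ s)"

lemma grad_component: "grad g c u q $ l = (\<Sum>i\<in>UNIV. gi q $ l $ i * cpd c i u q)"
  by (simp add: grad_def differential_def matrix_vector_mult_def)

lemma grad_C: "C (Suc k) u \<Longrightarrow> C k (\<lambda>q. grad g c u q $ l)"
  unfolding grad_component by (intro C_sum C_mult gi_C C_cpd)

lemma metric_grad: "q \<in> U \<Longrightarrow> g c q *v grad g c u q = differential c u q"
  by (simp add: grad_def matrix_vector_mul_assoc gi_mul)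

lemma hess_sym:
  assumes "q \<in> U" "C 2 u"
  shows "hess g c u q $ i $ j = hess g c u q $ j $ i"
  by (simp add: hess_def cpd_commute[OF assms, of i j] christoffel_sym[OF assms(1), of _ i j])

text \<open>Raising an index commutes with covariant differentiation, since the inverse metric is
  parallel.\<close>

lemma hess_endo_eq_cov:
  assumes "q \<in> U" "C 2 u"
  shows "hess_endo g c u q $ l $ j = cov u l j q"
proof -
  have C1: "C 1 (cpd c i u)" for i using assms(2) C_cpd[of 1 u] by (simp add: numeral_2_eq_2)
  let ?u = "differential c u q" and ?P = "conn j q"
  let ?du = "\<chi> i. cpd c j (cpd c i u) q"
  have "cpd c j (\<lambda>r. grad g c u r $ l) q
      = (gi q *v ?du + (\<chi> i l. cpd c j (\<lambda>r. gi r $ i $ l) q) *v ?u) $ l"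
    by (simp add: grad_component cpd_sum[OF assms(1)] cpd_mult[OF assms(1)] C_mult gi_C C1[simplified]
        matrix_vector_mult_def sum.distrib differential_def)
  \<comment> \<open>One part of the derivative of \<open>gi\<close> completes the second derivatives
    of u to the Hessian; the other cancels the Christoffel term in \<open>cov\<close>.\<close>
  also have "\<dots> = (gi q *v (?du - transpose ?P *v ?u) - ?P *v grad g c u q) $ l"
  proof -
    have "- (gi q ** transpose ?P + ?P ** gi q) *v ?u
        = - (gi q *v (transpose ?P *v ?u)) - ?P *v grad g c u q"
      unfolding matrix_vector_mult_uminus matrix_vector_mult_add_rdistrib grad_def
        matrix_vector_mul_assoc by simp
    then show ?thesis
      unfolding cpd_gi[OF assms(1)] matrix_vector_mult_diff_distrib by simp
  qed
  finally have "cov u l j q = (gi q *v (?du - transpose ?P *v ?u)) $ l"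
    by (simp add: cov_def conn_def matrix_vector_mult_def)
  also have "?du - transpose ?P *v ?u = (\<chi> i. hess g c u q $ i $ j)"
    unfolding vec_eq_iff vec_lambda_beta hess_sym[OF assms, of _ j]
    by (simp add: hess_def conn_def matrix_vector_mult_def differential_def del: transpose_matrix_vector)
      (simp add: transpose_def)
  also have "(gi q *v (\<chi> i. hess g c u q $ i $ j)) $ l = hess_endo g c u q $ l $ j"
    by (simp add: hess_endo_def matrix_vector_mult_def matrix_matrix_mult_def)
  finally show ?thesis by simp
qed

end

section \<open>Bochner's formula\<close>

text \<open>The pointwise algebra of Bochner's formula: \<open>V\<close>, \<open>dV\<close>, \<open>ddV\<close> are the components and coordinate
  derivatives of a vector field, \<open>T\<close> and \<open>dT\<close> those of its covariant derivative. The left-hand side is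
  the divergence of \<open>\<nabla>\<^sub>V V\<close>. Since only \<open>\<nabla>\<^sub>l\<nabla>\<^sub>k V\<^sup>l\<close> has to be commuted, neither a metric nor
  symmetries of the curvature tensor are needed.\<close>

lemma vector_bochner_identity:
  fixes V :: "'n::finite \<Rightarrow> real" and dV :: "'n \<Rightarrow> 'n \<Rightarrow> real" and ddV \<Gamma> :: "'n \<Rightarrow> 'n \<Rightarrow> 'n \<Rightarrow> real"
    and d\<Gamma> :: "'n \<Rightarrow> 'n \<Rightarrow> 'n \<Rightarrow> 'n \<Rightarrow> real"
  assumes ddV: "\<And>l i j. ddV i j l = ddV j i l"
    and sym: "\<And>l i j. \<Gamma> l i j = \<Gamma> l j i"
    and T: "\<And>l j. T l j = dV j l + (\<Sum>s\<in>UNIV. \<Gamma> l j s * V s)"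
    and dT: "\<And>i l j. dT i l j = ddV i j l + (\<Sum>s\<in>UNIV. \<Gamma> l j s * dV i s + d\<Gamma> i l j s * V s)"
    and R: "\<And>l k i j. R l k i j = d\<Gamma> i l j k - d\<Gamma> j l i k
      + (\<Sum>s\<in>UNIV. \<Gamma> l i s * \<Gamma> s j k - \<Gamma> l j s * \<Gamma> s i k)"
  shows "(\<Sum>l\<in>UNIV. (\<Sum>k\<in>UNIV. T l k * dV l k + dT l l k * V k)
        + (\<Sum>s\<in>UNIV. \<Gamma> l l s * (\<Sum>k\<in>UNIV. T s k * V k)))
      = (\<Sum>k\<in>UNIV. V k * (\<Sum>l\<in>UNIV. dT k l l)) + (\<Sum>l\<in>UNIV. \<Sum>k\<in>UNIV. T l k * T k l)
        + (\<Sum>k\<in>UNIV. V k * (\<Sum>j\<in>UNIV. (\<Sum>l\<in>UNIV. R l j l k) * V j))"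
proof -
  \<comment> \<open>Trading coordinate derivatives of \<open>V\<close> for \<open>T\<close> leaves
    products of two Christoffel symbols, which are exactly the quadratic part of the
    curvature.\<close>
  have dV: "dV l k = T k l - (\<Sum>s\<in>UNIV. \<Gamma> k l s * V s)" for k l
    by (simp add: T)
  \<comment> \<open>The traced Ricci identity: the divergence of \<open>T\<close>, with both
    Christoffel corrections, equals the derivative of its trace plus Ric applied to
    \<open>V\<close>. Second derivatives of \<open>V\<close> cancel by \<open>ddV\<close>.\<close>
  have curv: "(\<Sum>l\<in>UNIV. dT l l k) + (\<Sum>l\<in>UNIV. \<Sum>s\<in>UNIV. \<Gamma> l l s * T s k)
      - (\<Sum>l\<in>UNIV. \<Sum>s\<in>UNIV. \<Gamma> s l k * T l s)
    = (\<Sum>l\<in>UNIV. dT k l l) + (\<Sum>j\<in>UNIV. (\<Sum>l\<in>UNIV. R l j l k) * V j)" for k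
  proof -
    have swap: "(\<Sum>l\<in>UNIV. \<Sum>s\<in>UNIV. \<Gamma> s l k * T l s) = (\<Sum>l\<in>UNIV. \<Sum>s\<in>UNIV. \<Gamma> l k s * T s l)"
      by (subst sum.swap) (simp add: sym[of _ _ k])
    have "(\<Sum>l\<in>UNIV. dT l l k) - (\<Sum>l\<in>UNIV. dT k l l)
      = (\<Sum>l\<in>UNIV. \<Sum>s\<in>UNIV. \<Gamma> l k s * dV l s + d\<Gamma> l l k s * V s - (\<Gamma> l l s * dV k s + d\<Gamma> k l l s * V s))"
      by (simp add: dT sum_subtractf sum.distrib ddV[of k])
    also have "\<dots> = (\<Sum>l\<in>UNIV. \<Sum>s\<in>UNIV. \<Gamma> l k s * T s l - \<Gamma> l l s * T s k)
       + (\<Sum>l\<in>UNIV. \<Sum>s\<in>UNIV. (d\<Gamma> l l k s - d\<Gamma> k l l s) * V s)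
       + (\<Sum>l\<in>UNIV. \<Sum>s\<in>UNIV. \<Sum>t\<in>UNIV. (\<Gamma> l l s * \<Gamma> s k t - \<Gamma> l k s * \<Gamma> s l t) * V t)"
      by (simp add: dV sum_subtractf sum.distrib algebra_simps sum_distrib_left)
    also have "(\<Sum>l\<in>UNIV. \<Sum>s\<in>UNIV. \<Sum>t\<in>UNIV. (\<Gamma> l l s * \<Gamma> s k t - \<Gamma> l k s * \<Gamma> s l t) * V t)
       = (\<Sum>l\<in>UNIV. \<Sum>t\<in>UNIV. (\<Sum>s\<in>UNIV. \<Gamma> l l s * \<Gamma> s k t - \<Gamma> l k s * \<Gamma> s l t) * V t)"
      by (rule sum.cong[OF refl]) (subst sum.swap, simp add: sum_distrib_right)
    also have "(\<Sum>l\<in>UNIV. \<Sum>s\<in>UNIV. \<Gamma> l k s * T s l - \<Gamma> l l s * T s k)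
       + (\<Sum>l\<in>UNIV. \<Sum>s\<in>UNIV. (d\<Gamma> l l k s - d\<Gamma> k l l s) * V s) + \<dots>
       = (\<Sum>l\<in>UNIV. \<Sum>s\<in>UNIV. \<Gamma> l k s * T s l - \<Gamma> l l s * T s k)
       + (\<Sum>l\<in>UNIV. \<Sum>j\<in>UNIV. R l j l k * V j)"
      by (simp add: R sum.distrib sum_subtractf algebra_simps)
    also have "(\<Sum>l\<in>UNIV. \<Sum>j\<in>UNIV. R l j l k * V j) = (\<Sum>j\<in>UNIV. (\<Sum>l\<in>UNIV. R l j l k) * V j)"
      by (subst sum.swap) (simp add: sum_distrib_right)
    finally show ?thesis by (simp add: swap sum_subtractf)
  qed
  \<comment> \<open>This yields tr T^2 and, with a minus sign, the lower-index correction in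
    \<open>curv\<close>; facts \<open>2\<close> and \<open>3\<close> below bring its other two terms
    into the same form.\<close>
  have "(\<Sum>l\<in>UNIV. \<Sum>k\<in>UNIV. T l k * dV l k)
     = (\<Sum>l\<in>UNIV. \<Sum>k\<in>UNIV. T l k * T k l) - (\<Sum>l\<in>UNIV. \<Sum>k\<in>UNIV. \<Sum>s\<in>UNIV. V s * (\<Gamma> k l s * T l k))"
    by (simp add: dV algebra_simps sum_subtractf sum_distrib_left)
  also have "(\<Sum>l\<in>UNIV. \<Sum>k\<in>UNIV. \<Sum>s\<in>UNIV. V s * (\<Gamma> k l s * T l k))
     = (\<Sum>l\<in>UNIV. \<Sum>s\<in>UNIV. \<Sum>k\<in>UNIV. V s * (\<Gamma> k l s * T l k))"
    by (rule sum.cong[OF refl], rule sum.swap)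
  also have "\<dots> = (\<Sum>s\<in>UNIV. V s * (\<Sum>l\<in>UNIV. \<Sum>k\<in>UNIV. \<Gamma> k l s * T l k))"
    by (subst sum.swap) (simp add: sum_distrib_left)
  finally have 1: "(\<Sum>l\<in>UNIV. \<Sum>k\<in>UNIV. T l k * dV l k) = (\<Sum>l\<in>UNIV. \<Sum>k\<in>UNIV. T l k * T k l)
     - (\<Sum>s\<in>UNIV. V s * (\<Sum>l\<in>UNIV. \<Sum>k\<in>UNIV. \<Gamma> k l s * T l k))" .
  have 2: "(\<Sum>l\<in>UNIV. \<Sum>s\<in>UNIV. \<Gamma> l l s * (\<Sum>k\<in>UNIV. T s k * V k))
     = (\<Sum>k\<in>UNIV. V k * (\<Sum>l\<in>UNIV. \<Sum>s\<in>UNIV. \<Gamma> l l s * T s k))"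
  proof -
    have "(\<Sum>l\<in>UNIV. \<Sum>s\<in>UNIV. \<Gamma> l l s * (\<Sum>k\<in>UNIV. T s k * V k))
      = (\<Sum>l\<in>UNIV. \<Sum>k\<in>UNIV. \<Sum>s\<in>UNIV. V k * (\<Gamma> l l s * T s k))"
      by (rule sum.cong[OF refl], subst sum.swap) (simp add: sum_distrib_left algebra_simps)
    also have "\<dots> = (\<Sum>k\<in>UNIV. V k * (\<Sum>l\<in>UNIV. \<Sum>s\<in>UNIV. \<Gamma> l l s * T s k))"
      by (subst sum.swap) (simp add: sum_distrib_left)
    finally show ?thesis .
  qed
  have 3: "(\<Sum>l\<in>UNIV. \<Sum>k\<in>UNIV. dT l l k * V k) = (\<Sum>k\<in>UNIV. V k * (\<Sum>l\<in>UNIV. dT l l k))"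
    by (subst sum.swap) (simp add: sum_distrib_left mult.commute)
  have "(\<Sum>k\<in>UNIV. V k * (\<Sum>l\<in>UNIV. dT l l k)) + (\<Sum>k\<in>UNIV. V k * (\<Sum>l\<in>UNIV. \<Sum>s\<in>UNIV. \<Gamma> l l s * T s k))
      - (\<Sum>k\<in>UNIV. V k * (\<Sum>l\<in>UNIV. \<Sum>s\<in>UNIV. \<Gamma> s l k * T l s))
    = (\<Sum>k\<in>UNIV. V k * ((\<Sum>l\<in>UNIV. dT l l k) + (\<Sum>l\<in>UNIV. \<Sum>s\<in>UNIV. \<Gamma> l l s * T s k)
      - (\<Sum>l\<in>UNIV. \<Sum>s\<in>UNIV. \<Gamma> s l k * T l s)))"
    by (simp add: sum.distrib sum_subtractf algebra_simps)
  also have "\<dots> = (\<Sum>k\<in>UNIV. V k * (\<Sum>l\<in>UNIV. dT k l l))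
     + (\<Sum>k\<in>UNIV. V k * (\<Sum>j\<in>UNIV. (\<Sum>l\<in>UNIV. R l j l k) * V j))"
    unfolding curv by (simp add: sum.distrib algebra_simps)
  finally show ?thesis
    unfolding sum.distrib 1 2 3 by linarith
qed

section \<open>Covariant derivatives of gradients and Bochner's formula in a chart\<close>

context chart_metric
begin

lemma cov_C:
  assumes "C (Suc (Suc k)) u"
  shows "C k (cov u l j)"
  using C_cpd[OF grad_C[OF assms]] C_le[OF grad_C[OF assms], of k]
  by (simp add: cov_def[abs_def] C_add C_sum C_mult christoffel_C)

lemma laplacian_eq_cov:
  assumes "q \<in> U" "C 2 u"
  shows "laplacian g c u q = (\<Sum>l\<in>UNIV. cov u l l q)"
  unfolding laplacian_def trace_def hess_endo_eq_cov[OF assms] ..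

lemma ip_grad: "q \<in> U \<Longrightarrow> ip g c q \<xi> (grad g c u q) = (\<Sum>k\<in>UNIV. cpd c k u q * \<xi> $ k)"
  by (simp add: ip_def metric_grad inner_vec_def differential_def mult.commute)

text \<open>Reading g(grad u, grad w) as dw(grad u) avoids differentiating the metric. The
  Christoffel terms left over when second derivatives of w become Hess w complete the derivative of
  grad u to a covariant one.\<close>

lemma cpd_ip_grad:
  assumes "q \<in> U" "C 2 u" "C 2 w"
  shows "cpd c i (\<lambda>r. ip g c r (grad g c u r) (grad g c w r)) q
    = (\<Sum>k\<in>UNIV. hess g c w q $ i $ k * grad g c u q $ k)
      + (\<Sum>k\<in>UNIV. cpd c k w q * cov u k i q)"
proof -
  have C1: "C 1 (cpd c k w)" "C 1 (\<lambda>q. grad g c u q $ k)" for k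
    using assms C_cpd[of 1 w] grad_C[of 1 u] by (simp_all add: numeral_2_eq_2)
  have "cpd c i (\<lambda>r. ip g c r (grad g c u r) (grad g c w r)) q
      = cpd c i (\<lambda>r. \<Sum>k\<in>UNIV. cpd c k w r * grad g c u r $ k) q"
    by (rule cpd_cong[OF assms(1)]) (rule ip_grad)
  also have "\<dots> = (\<Sum>k\<in>UNIV. cpd c k w q * cpd c i (\<lambda>r. grad g c u r $ k) q
      + cpd c i (cpd c k w) q * grad g c u q $ k)"
    by (simp add: cpd_sum[OF assms(1)] cpd_mult[OF assms(1)] C_mult C1[simplified])
  also have "\<dots> = (\<Sum>k\<in>UNIV. cpd c k w q * cpd c i (\<lambda>r. grad g c u r $ k) q)
      + (\<Sum>k\<in>UNIV. hess g c w q $ i $ k * grad g c u q $ k)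
      + (\<Sum>k\<in>UNIV. \<Sum>s\<in>UNIV. christoffel g c s i k q * cpd c s w q * grad g c u q $ k)"
    by (simp add: hess_def sum.distrib sum_subtractf algebra_simps sum_distrib_left)
  also have "(\<Sum>k\<in>UNIV. \<Sum>s\<in>UNIV. christoffel g c s i k q * cpd c s w q * grad g c u q $ k)
      = (\<Sum>s\<in>UNIV. cpd c s w q * (\<Sum>k\<in>UNIV. christoffel g c s i k q * grad g c u q $ k))"
    by (subst sum.swap) (simp add: sum_distrib_left algebra_simps)
  finally show ?thesis
    by (simp add: cov_def sum.distrib algebra_simps)
qed

text \<open>Both sides are Hess u in the \<open>i\<close>-th coordinate direction and grad w;
  symmetry of the Hessian and of the inverse metric lets the index be raised on either
  factor.\<close>

lemma hess_grad:
  assumes "q \<in> U" "C 2 u"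
  shows "(\<Sum>k\<in>UNIV. hess g c u q $ i $ k * grad g c w q $ k) = (\<Sum>k\<in>UNIV. cpd c k w q * cov u k i q)"
proof -
  have "gi q $ k $ l * hess g c u q $ i $ k = gi q $ l $ k * hess g c u q $ k $ i" for k l
    using arg_cong[OF gi_sym[OF assms(1)], of "\<lambda>M. M $ l $ k"] hess_sym[OF assms, of i k]
    by (simp add: transpose_def)
  then have cov: "(\<Sum>k\<in>UNIV. gi q $ k $ l * hess g c u q $ i $ k) = cov u l i q" for l
    by (simp add: hess_endo_eq_cov[OF assms, symmetric] hess_endo_def matrix_matrix_mult_def)
  have "(\<Sum>k\<in>UNIV. hess g c u q $ i $ k * grad g c w q $ k)
      = (\<Sum>k\<in>UNIV. \<Sum>l\<in>UNIV. cpd c l w q * (gi q $ k $ l * hess g c u q $ i $ k))"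
    by (simp add: grad_component sum_distrib_left algebra_simps)
  also have "\<dots> = (\<Sum>l\<in>UNIV. cpd c l w q * (\<Sum>k\<in>UNIV. gi q $ k $ l * hess g c u q $ i $ k))"
    by (subst sum.swap) (simp add: sum_distrib_left)
  finally show ?thesis by (simp add: cov)
qed

lemma cpd_grad_norm_sq:
  assumes "q \<in> U" "C 2 u"
  shows "cpd c i (grad_norm_sq g c u) q = 2 * (\<Sum>k\<in>UNIV. hess g c u q $ i $ k * grad g c u q $ k)"
  using cpd_ip_grad[OF assms assms(2)] hess_grad[OF assms, of i u]
  by (simp add: grad_norm_sq_def[abs_def])

text \<open>Half of this field is the derivative of grad u along itself, so the Laplacian of |grad
  u|^2 / 2 is the divergence treated in \<open>vector_bochner_identity\<close>.\<close>

lemma grad_grad_norm_sq: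
  assumes "q \<in> U" "C 2 u"
  shows "grad g c (grad_norm_sq g c u) q $ l = 2 * (\<Sum>k\<in>UNIV. cov u l k q * grad g c u q $ k)"
proof -
  have "grad g c (grad_norm_sq g c u) q $ l
     = 2 * (\<Sum>i\<in>UNIV. \<Sum>k\<in>UNIV. gi q $ l $ i * hess g c u q $ i $ k * grad g c u q $ k)"
    by (simp add: grad_component[of "grad_norm_sq g c u"] cpd_grad_norm_sq[OF assms]
        sum_distrib_left algebra_simps)
  also have "(\<Sum>i\<in>UNIV. \<Sum>k\<in>UNIV. gi q $ l $ i * hess g c u q $ i $ k * grad g c u q $ k)
     = (\<Sum>k\<in>UNIV. hess_endo g c u q $ l $ k * grad g c u q $ k)"
    by (subst sum.swap) (simp add: hess_endo_def matrix_matrix_mult_def sum_distrib_right)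
  finally show ?thesis by (simp add: hess_endo_eq_cov[OF assms])
qed

lemma grad_norm_sq_C:
  assumes "C (Suc k) u"
  shows "C k (grad_norm_sq g c u)"
proof -
  have "C k (\<lambda>q. \<Sum>i\<in>UNIV. cpd c i u q * grad g c u q $ i)"
    by (intro C_sum C_mult C_cpd grad_C assms)
  then show ?thesis
    by (subst C_cong) (simp_all add: grad_norm_sq_def ip_grad)
qed

theorem bochner:
  assumes "q \<in> U" "C 3 u"
  shows "laplacian g c (grad_norm_sq g c u) q / 2
    = ip g c q (grad g c u q) (grad g c (laplacian g c u) q)
      + trace (hess_endo g c u q ** hess_endo g c u q)
      + grad g c u q \<bullet> (ricci g c q *v grad g c u q)"
proof -
  have C2: "C 2 u" using C_le[OF assms(2)] by simp
  have C3: "C (Suc (Suc 1)) u" using assms(2) by (simp add: numeral_3_eq_3)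
  have T1: "C 1 (cov u l j)" for l j by (rule cov_C[OF C3])
  \<comment> \<open>Order 2 is what the commutation of second derivatives of the gradient components
    requires.\<close>
  have V2: "C 2 (\<lambda>q. grad g c u q $ l)" for l
    using grad_C[OF C3] by (simp add: numeral_2_eq_2)
  have V1: "C 1 (\<lambda>q. grad g c u q $ l)" "C 1 (cpd c i (\<lambda>q. grad g c u q $ l))" for l i
    using V2 C_le[OF V2, of 1] C_cpd[of 1] by (simp_all add: numeral_2_eq_2)
  let ?V = "\<lambda>l. grad g c u q $ l" and ?T = "\<lambda>l j. cov u l j q"
  let ?dV = "\<lambda>i l. cpd c i (\<lambda>r. grad g c u r $ l) q"
  let ?dT = "\<lambda>i l j. cpd c i (cov u l j) q"
  let ?\<Gamma> = "\<lambda>l i j. christoffel g c l i j q"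
  have dT: "?dT i l j = cpd c i (cpd c j (\<lambda>r. grad g c u r $ l)) q
     + (\<Sum>s\<in>UNIV. ?\<Gamma> l j s * ?dV i s + cpd c i (christoffel g c l j s) q * ?V s)" for i l j
    unfolding cov_def[abs_def]
    by (simp add: cpd_add[OF assms(1)] cpd_sum[OF assms(1)] cpd_mult[OF assms(1)] C_sum C_mult
        V1[simplified] christoffel_C)
  have main: "(\<Sum>l\<in>UNIV. (\<Sum>k\<in>UNIV. ?T l k * ?dV l k + ?dT l l k * ?V k)
        + (\<Sum>s\<in>UNIV. ?\<Gamma> l l s * (\<Sum>k\<in>UNIV. ?T s k * ?V k)))
      = (\<Sum>k\<in>UNIV. ?V k * (\<Sum>l\<in>UNIV. ?dT k l l)) + (\<Sum>l\<in>UNIV. \<Sum>k\<in>UNIV. ?T l k * ?T k l)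
        + (\<Sum>k\<in>UNIV. ?V k * (\<Sum>j\<in>UNIV. (\<Sum>l\<in>UNIV. riemann g c l j l k q) * ?V j))"
  proof (rule vector_bochner_identity[where V = ?V and dV = ?dV and T = ?T and dT = ?dT and \<Gamma> = ?\<Gamma>
        and ddV = "\<lambda>i j l. cpd c i (cpd c j (\<lambda>r. grad g c u r $ l)) q"
        and d\<Gamma> = "\<lambda>i l j s. cpd c i (christoffel g c l j s) q"
        and R = "\<lambda>l k i j. riemann g c l k i j q"])
    show "cpd c i (cpd c j (\<lambda>r. grad g c u r $ l)) q = cpd c j (cpd c i (\<lambda>r. grad g c u r $ l)) q" for l i j
      by (rule cpd_commute[OF assms(1) V2])
  qed (rule christoffel_sym[OF assms(1)] cov_def dT riemann_def)+
  \<comment> \<open>The Leibniz rule for twice \<open>T\<close> applied to the gradient; summed over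
    \<open>l\<close>, this is twice the left-hand side of \<open>main\<close>.\<close>
  have lap_E: "cov (grad_norm_sq g c u) l l q = 2 * ((\<Sum>k\<in>UNIV. ?T l k * ?dV l k + ?dT l l k * ?V k)
        + (\<Sum>s\<in>UNIV. ?\<Gamma> l l s * (\<Sum>k\<in>UNIV. ?T s k * ?V k)))" for l
  proof -
    have "cpd c l (\<lambda>r. grad g c (grad_norm_sq g c u) r $ l) q
      = cpd c l (\<lambda>r. 2 * (\<Sum>k\<in>UNIV. cov u l k r * grad g c u r $ k)) q"
      by (rule cpd_cong[OF assms(1)]) (rule grad_grad_norm_sq[OF _ C2])
    also have "\<dots> = 2 * (\<Sum>k\<in>UNIV. ?T l k * ?dV l k + ?dT l l k * ?V k)"
      by (simp add: cpd_sum[OF assms(1)] cpd_mult[OF assms(1)] C_sum C_mult C_const cpd_const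
        V1[simplified] T1[simplified])
    finally show ?thesis
      by (simp add: cov_def[of "grad_norm_sq g c u"] grad_grad_norm_sq[OF assms(1) C2]
          sum_distrib_left algebra_simps)
  qed
  have "cpd c k (laplacian g c u) q = cpd c k (\<lambda>r. \<Sum>l\<in>UNIV. cov u l l r) q" for k
    by (rule cpd_cong[OF assms(1)]) (rule laplacian_eq_cov[OF _ C2])
  then have lap_u: "ip g c q (grad g c u q) (grad g c (laplacian g c u) q)
      = (\<Sum>k\<in>UNIV. ?V k * (\<Sum>l\<in>UNIV. ?dT k l l))"
    by (simp add: ip_grad[OF assms(1)] cpd_sum[OF assms(1)] T1[simplified] mult.commute)
  have tr: "trace (hess_endo g c u q ** hess_endo g c u q) = (\<Sum>l\<in>UNIV. \<Sum>k\<in>UNIV. ?T l k * ?T k l)"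
    by (simp add: trace_def matrix_matrix_mult_def hess_endo_eq_cov[OF assms(1) C2])
  have ric: "grad g c u q \<bullet> (ricci g c q *v grad g c u q)
      = (\<Sum>k\<in>UNIV. ?V k * (\<Sum>j\<in>UNIV. (\<Sum>l\<in>UNIV. riemann g c l j l k q) * ?V j))"
    by (simp add: inner_vec_def matrix_vector_mult_def ricci_def)
  have "C 2 (grad_norm_sq g c u)"
    by (rule grad_norm_sq_C) (use assms(2) in simp)
  then have "laplacian g c (grad_norm_sq g c u) q = (\<Sum>l\<in>UNIV. cov (grad_norm_sq g c u) l l q)"
    by (rule laplacian_eq_cov[OF assms(1)])
  also have "\<dots> = 2 * (\<Sum>l\<in>UNIV. (\<Sum>k\<in>UNIV. ?T l k * ?dV l k + ?dT l l k * ?V k)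
        + (\<Sum>s\<in>UNIV. ?\<Gamma> l l s * (\<Sum>k\<in>UNIV. ?T s k * ?V k)))"
    unfolding lap_E by (rule sum_distrib_left[symmetric])
  finally show ?thesis
    unfolding main lap_u tr ric by simp
qed

section \<open>The weighted Laplacian and the weighted Bochner formula\<close>

lemma ip_sym:
  assumes "q \<in> U"
  shows "ip g c q \<xi> \<eta> = ip g c q \<eta> \<xi>"
  using inner_mult_symmetric[OF metric_sym[OF assms], of \<xi> \<eta>]
  by (simp add: ip_def inner_commute)

lemma laplacian_C:
  assumes "C (Suc (Suc k)) u"
  shows "C k (laplacian g c u)"
proof -
  have "C 2 u" using C_le[OF assms] by simp
  moreover have "C k (\<lambda>q. \<Sum>l\<in>UNIV. cov u l l q)"
    by (intro C_sum cov_C assms)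
  ultimately show ?thesis
    by (subst C_cong[OF laplacian_eq_cov])
qed

lemma ip_grad_C:
  assumes "C (Suc k) u" "C (Suc k) w"
  shows "C k (\<lambda>q. ip g c q (grad g c u q) (grad g c w q))"
proof -
  have "C k (\<lambda>q. \<Sum>i\<in>UNIV. cpd c i w q * grad g c u q $ i)"
    by (intro C_sum C_mult C_cpd grad_C assms)
  then show ?thesis by (subst C_cong[OF ip_grad])
qed

lemma weighted_laplacian_C:
  assumes "C (Suc (Suc k)) u" "C (Suc k) f"
  shows "C k (weighted_laplacian g c f u)"
  unfolding weighted_laplacian_def
  using C_le[OF assms(1), of "Suc k"] assms
  by (intro C_diff laplacian_C ip_grad_C) simp_all

text \<open>Differentiating g(grad f, grad u) along grad u gives Hess u(grad f, grad u) and Hess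
  f(grad u, grad u). The first matches the drift term of the left-hand side, the second joins the
  Ricci term. The last summand removes the square contained in \<open>ric_weighted\<close>.\<close>

lemma weighted_bochner:
  fixes m :: real
  assumes q: "q \<in> U" and u: "C 3 u" and f: "C 2 f" and m: "m \<noteq> 0"
  shows "weighted_laplacian g c f (grad_norm_sq g c u) q / 2
    = ip g c q (grad g c u q) (grad g c (weighted_laplacian g c f u) q)
      + trace (hess_endo g c u q ** hess_endo g c u q)
      + grad g c u q \<bullet> (ric_weighted g c f (CARD('n) - m) q *v grad g c u q)
      - (ip g c q (grad g c f q) (grad g c u q))\<^sup>2 / m"
proof -
  have C2: "C 2 u" using C_le[OF u] by simp
  let ?V = "grad g c u q"
  have lap_C: "C 1 (laplacian g c u)"
    using u by (intro laplacian_C) (simp add: numeral_3_eq_3)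
  have ip_C: "C 1 (\<lambda>q. ip g c q (grad g c f q) (grad g c u q))"
    using C2 f by (intro ip_grad_C) (simp_all add: numeral_2_eq_2)
  have "cpd c i (weighted_laplacian g c f u) q = cpd c i (laplacian g c u) q
     - ((\<Sum>k\<in>UNIV. hess g c u q $ i $ k * grad g c f q $ k) + (\<Sum>k\<in>UNIV. cpd c k u q * cov f k i q))" for i
    unfolding weighted_laplacian_def[abs_def]
    by (simp only: cpd_diff[OF q lap_C ip_C] cpd_ip_grad[OF q f C2])
  moreover have "(\<Sum>k\<in>UNIV. cpd c k u q * cov f k i q) = (\<Sum>k\<in>UNIV. hess g c f q $ i $ k * ?V $ k)" for i
    by (rule hess_grad[OF q f, symmetric])
  ultimately have "ip g c q ?V (grad g c (weighted_laplacian g c f u) q)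
    = (\<Sum>i\<in>UNIV. (cpd c i (laplacian g c u) q - ((\<Sum>k\<in>UNIV. hess g c u q $ i $ k * grad g c f q $ k)
        + (\<Sum>k\<in>UNIV. hess g c f q $ i $ k * ?V $ k))) * ?V $ i)"
    by (simp add: ip_grad[OF q])
  also have "\<dots> = ip g c q ?V (grad g c (laplacian g c u) q)
      - (\<Sum>i\<in>UNIV. (\<Sum>k\<in>UNIV. hess g c u q $ i $ k * grad g c f q $ k) * ?V $ i)
      - ?V \<bullet> (hess g c f q *v ?V)"
    by (simp add: ip_grad[OF q] inner_vec_def matrix_vector_mult_def sum_subtractf sum.distrib
        algebra_simps)
  also have "(\<Sum>i\<in>UNIV. (\<Sum>k\<in>UNIV. hess g c u q $ i $ k * grad g c f q $ k) * ?V $ i)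
      = ip g c q (grad g c f q) (grad g c (grad_norm_sq g c u) q) / 2"
  proof -
    have "(\<Sum>i\<in>UNIV. (\<Sum>k\<in>UNIV. hess g c u q $ i $ k * grad g c f q $ k) * ?V $ i)
       = (\<Sum>i\<in>UNIV. \<Sum>k\<in>UNIV. hess g c u q $ k $ i * grad g c f q $ k * ?V $ i)"
      by (simp add: sum_distrib_right hess_sym[OF q C2])
    also have "\<dots> = (\<Sum>k\<in>UNIV. (\<Sum>i\<in>UNIV. hess g c u q $ k $ i * ?V $ i) * grad g c f q $ k)"
      by (subst sum.swap) (simp add: sum_distrib_left algebra_simps)
    finally show ?thesis
      by (simp add: ip_grad[OF q] cpd_grad_norm_sq[OF q C2] sum_distrib_left algebra_simps)
  qed
  finally have grad_wl: "ip g c q ?V (grad g c (weighted_laplacian g c f u) q)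
    = ip g c q ?V (grad g c (laplacian g c u) q)
      - ip g c q (grad g c f q) (grad g c (grad_norm_sq g c u) q) / 2
      - ?V \<bullet> (hess g c f q *v ?V)" .
  have ip_f: "ip g c q (grad g c f q) ?V = (\<Sum>i\<in>UNIV. differential c f q $ i * ?V $ i)"
    using ip_sym[OF q, of "grad g c f q" ?V] by (simp add: ip_grad[OF q] differential_def)
  define w where "w i = differential c f q $ i" for i
  have "(\<Sum>i\<in>UNIV. ?V $ i * (\<Sum>j\<in>UNIV. - (w i * w j * ?V $ j / m)))
      = - ((\<Sum>i\<in>UNIV. w i * ?V $ i) * (\<Sum>i\<in>UNIV. w i * ?V $ i)) / m"
    unfolding sum_product by (simp add: sum_distrib_left sum_negf sum_divide_distrib algebra_simps)
  \<comment> \<open>The denominator N - n is -m, so subtracting this tensor in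
    \<open>ric_weighted\<close> adds a non-negative square when m > 0.\<close>
  then have "?V \<bullet> ((\<chi> i j. differential c f q $ i * differential c f q $ j / (- m)) *v ?V)
      = - ((\<Sum>i\<in>UNIV. differential c f q $ i * ?V $ i)\<^sup>2 / m)"
    by (simp add: inner_vec_def matrix_vector_mult_def w_def power2_eq_square)
  then have ric: "?V \<bullet> (ric_weighted g c f (CARD('n) - m) q *v ?V) = ?V \<bullet> (ricci g c q *v ?V)
      + ?V \<bullet> (hess g c f q *v ?V) + (ip g c q (grad g c f q) ?V)\<^sup>2 / m"
    by (simp add: ric_weighted_def matrix_vector_mult_diff_rdistrib
        matrix_vector_mult_add_rdistrib inner_add_right inner_diff_right ip_f)
  show ?thesis
    unfolding grad_wl ric weighted_laplacian_def[of g c f "grad_norm_sq g c u"]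
    using bochner[OF q u] by (simp add: field_simps)
qed

lemma hess_endo_self_adjoint:
  assumes "q \<in> U" "C 2 u"
  shows "transpose (g c q ** hess_endo g c u q) = g c q ** hess_endo g c u q"
proof -
  have "g c q ** hess_endo g c u q = hess g c u q"
    by (simp add: hess_endo_def matrix_mul_assoc gi_mul[OF assms(1)])
  then show ?thesis
    by (simp add: transpose_def vec_eq_iff hess_sym[OF assms])
qed

text \<open>The factor 2 / a is the logarithmic derivative of the squared exponential with respect
  to f; with a = m it supplies the cross term of the square completed in the theorem.\<close>

lemma ip_grad_conformal:
  assumes "q \<in> U" "C 1 f" "C 1 w" "a \<noteq> 0"
  shows "ip g c q \<xi> (grad g c (\<lambda>r. (exp (f r / a))\<^sup>2 * w r) q)
    = (exp (f q / a))\<^sup>2 * (ip g c q \<xi> (grad g c w q) + 2 / a * w q * ip g c q \<xi> (grad g c f q))"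
proof -
  let ?e = "\<lambda>r. exp (f r / a)"
  have C: "C 1 ?e" "C 1 (\<lambda>r. f r / a)"
    using assms by (simp_all add: C_exp C_divide_const)
  have "cpd c i (\<lambda>r. (?e r)\<^sup>2 * w r) q
    = (?e q)\<^sup>2 * (cpd c i w q + 2 / a * w q * cpd c i f q)" for i
    unfolding power2_eq_square
    by (simp only: cpd_mult[OF assms(1) C_mult[OF C(1) C(1)] assms(3)] cpd_mult[OF assms(1) C(1) C(1)]
        cpd_exp[OF assms(1) C(2)] cpd_divide_const[OF assms(1,2)]) (simp add: field_simps)
  then show ?thesis
    by (simp add: ip_grad[OF assms(1)] sum_distrib_left sum.distrib algebra_simps)
qed

end

theorem lemma3p1:
  fixes X :: "'a topology"
    and A :: "('a, 'n::finite) chart set"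
    and g :: "('a, 'n) chart \<Rightarrow> 'a \<Rightarrow> real^'n^'n"
    and f h v :: "'a \<Rightarrow> real"
    and K :: real
    and m :: nat
    and W :: "'a set"
    and p :: 'a
    and c :: "('a, 'n) chart"
  assumes riem: "riemannian_manifold X A g"
    and f_smooth: "smooth_function A (topspace X) f"
    and m: "m \<in> {1..CARD('n)}"
    and cd: "CD A g f K (real CARD('n) - real m)"
    and W: "openin X W" "p \<in> W"
    and h_C3: "Ck_function 3 A W h"
    and chart: "c \<in> A" "p \<in> fst c"
    and eig: "num_nonzero_eigenvalues (hess_endo g c h p) = m"
    and v: "v = (\<lambda>q. exp (f q / real m))"
  shows "let
      Lap = weighted_laplacian g c f;
      Grad = grad g c;
      L = 1 / 2 * (v p)\<^sup>2 * Lap (grad_norm_sq g c h) p;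
      R = (v p)\<^sup>2 * (Lap h p)\<^sup>2 / real m + (v p)\<^sup>2 * K * grad_norm_sq g c h p
            + ip g c p (Grad h p) (Grad (\<lambda>q. (v q)\<^sup>2 * Lap h q) p)
    in L \<ge> R \<and>
       (L = R \<longleftrightarrow>
          (\<forall>\<mu>\<in>eigenvalues (hess_endo g c h p) - {0}.
             \<forall>\<nu>\<in>eigenvalues (hess_endo g c h p) - {0}. \<mu> = \<nu>) \<and>
          Grad h p \<bullet> (ric_weighted g c f (real CARD('n) - real m) p *v Grad h p)
            = K * grad_norm_sq g c h p)"
proof -
  interpret M: riemannian_manifold X A g by (rule riem)
  interpret chart_region X c W
    using M.charts[OF chart(1)] W(1) by unfold_locales
  interpret chart_metric X c W g
  proof
    show "C k (\<lambda>q. g c q $ i $ j)" for k i j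
      using M.metric_smooth[OF chart(1), of k i j] Ck_on_subset[OF _ image_mono[of "fst c \<inter> W" "fst c" "snd c"]]
      by (simp add: Ck_in_chart_def)
  qed (use M.metric_symmetric[OF chart(1)] M.metric_positive[OF chart(1)] in \<open>auto simp: U_def\<close>)
  have p: "p \<in> U" using chart(2) W(2) by (simp add: U_def)
  have h3: "C 3 h" using h_C3 chart(1) by (simp add: Ck_function_def)
  have fk: "C k f" for k
  proof -
    have "fst c \<subseteq> topspace X" using M.charts[OF chart(1)] openin_subset by (auto simp: is_chart_def)
    then have "fst c \<inter> W \<subseteq> fst c \<inter> topspace X" by blast
    moreover have "Ck_in_chart k c (topspace X) f"
      using f_smooth chart(1) by (simp add: smooth_function_def Ck_function_def)
    ultimately show ?thesis
      unfolding Ck_in_chart_def by (meson Ck_on_subset image_mono)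
  qed
  have h2: "C 2 h" using C_le[OF h3] by simp
  have m0: "m > 0" "real m \<noteq> 0" using m by auto
  define T where "T = hess_endo g c h p"
  define V where "V = grad g c h p"
  define d where "d = ip g c p (grad g c f p) V"
  define w where "w = (v p)\<^sup>2"
  define Ric where "Ric = V \<bullet> (ric_weighted g c f (real CARD('n) - real m) p *v V)"
  define E where "E = grad_norm_sq g c h p"
  define gradLap where "gradLap = ip g c p V (grad g c (weighted_laplacian g c f h) p)"
  have w: "w > 0" by (simp add: w_def v)
  have lap: "weighted_laplacian g c f h p = trace T - d"
    by (simp add: weighted_laplacian_def laplacian_def T_def d_def V_def)
  have bochner: "weighted_laplacian g c f (grad_norm_sq g c h) p / 2
      = gradLap + trace (T ** T) + Ric - d\<^sup>2 / real m"
    using weighted_bochner[OF p h3 fk m0(2)]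
    by (simp add: T_def V_def d_def Ric_def gradLap_def)
  have lap_C: "C 1 (weighted_laplacian g c f h)"
    by (rule weighted_laplacian_C[OF _ fk]) (use h3 in \<open>simp add: numeral_3_eq_3\<close>)
  have d_eq: "ip g c p V (grad g c f p) = d" by (simp only: d_def ip_sym[OF p, of V])
  have conf: "ip g c p V (grad g c (\<lambda>q. (v q)\<^sup>2 * weighted_laplacian g c f h q) p)
      = w * (gradLap + 2 / real m * (trace T - d) * d)"
    unfolding v ip_grad_conformal[OF p fk lap_C m0(2)] d_eq lap gradLap_def w_def ..
  define P where "P = trace (T ** T) - (trace T)\<^sup>2 / real m"
  define Q where "Q = Ric - K * E"
  \<comment> \<open>\<open>gradLap\<close> cancels, and (tr T - d)^2 + 2 (tr T - d) d + d^2 = (tr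
    T)^2: the summands come from the squared weighted Laplacian, the derivative of v^2 and the
    weighted Bochner formula, all with the factor 1/m.\<close>
  have diff: "1 / 2 * w * weighted_laplacian g c f (grad_norm_sq g c h) p
      - (w * (weighted_laplacian g c f h p)\<^sup>2 / real m + w * K * E
         + ip g c p V (grad g c (\<lambda>q. (v q)\<^sup>2 * weighted_laplacian g c f h q) p))
     = w * (P + Q)"
  proof -
    have L: "1 / 2 * w * weighted_laplacian g c f (grad_norm_sq g c h) p
        = w * (weighted_laplacian g c f (grad_norm_sq g c h) p / 2)"
      by simp
    show ?thesis
      unfolding L bochner conf lap P_def Q_def
      by (simp add: divide_inverse power2_eq_square algebra_simps)
  qed
  have T: "transpose (g c p ** T) = g c p ** T" "num_nonzero_eigenvalues T = m"
    unfolding T_def by (rule hess_endo_self_adjoint[OF p h2], rule eig)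
  have P_nonneg: "P \<ge> 0"
    using trace_square_ge(1)[of "g c p" T m, OF metric_sym[OF p] _ T m0(1)] metric_pos[OF p]
    by (simp add: P_def)
  have "(trace T)\<^sup>2 / real m = trace (T ** T) \<longleftrightarrow>
      (\<forall>\<mu>\<in>eigenvalues T - {0}. \<forall>\<nu>\<in>eigenvalues T - {0}. \<mu> = \<nu>)"
    by (rule trace_square_ge(2)[of "g c p" T m, OF metric_sym[OF p] _ T m0(1)]) (rule metric_pos[OF p])
  then have P_zero: "P = 0 \<longleftrightarrow> (\<forall>\<mu>\<in>eigenvalues T - {0}. \<forall>\<nu>\<in>eigenvalues T - {0}. \<mu> = \<nu>)"
    unfolding P_def by linarith
  have Q_nonneg: "Q \<ge> 0"
    using cd chart by (simp add: CD_def Q_def Ric_def E_def grad_norm_sq_def V_def)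
  have "w * (P + Q) \<ge> 0" using w P_nonneg Q_nonneg by simp
  \<comment> \<open>As \<open>P\<close> and \<open>Q\<close> are separately non-negative and
    \<open>w\<close> is positive, equality decouples into the eigenvalue condition and the curvature
    condition.\<close>
  moreover have "w * (P + Q) = 0 \<longleftrightarrow> P = 0 \<and> Q = 0"
    using w P_nonneg Q_nonneg by (simp add: add_nonneg_eq_0_iff)
  moreover have "Q = 0 \<longleftrightarrow> Ric = K * E" by (simp add: Q_def)
  ultimately show ?thesis
    unfolding Let_def T_def[symmetric] V_def[symmetric] w_def[symmetric] E_def[symmetric]
      Ric_def[symmetric] P_zero[symmetric] diff[symmetric]
    by linarith
qed

end
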